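(* Let $2 \leq n < \infty$, and let $u_1, \dots, u_n$ be the freely independent Haar unitaries generating $L\mathbb{F}_n$. For $1 \leq i \leq n$ let $A_i = \{u_i\}''$ and $B_i = \{u_i + u_i^*\}'' \subset A_i$, identify $A_i$ (in a trace-preserving way) with $L^\infty[-1,1]$ so that $B_i$ corresponds to the subalgebra of even functions, and let $w_i \in A_i$ be the unitary corresponding to the function $x \mapsto |x|/x$. Then for all $1 \leq i \neq j \leq n$ the unitary $v_{ij} = w_i w_j \in L\mathbb{F}_n$ is freely independent of the radial MASA $A_r \subset L\mathbb{F}_n$.
   Context: $L\mathbb{F}_n$ is the free group factor with its canonical trace $\tau$; $u_1,\dots,u_n$ are the unitaries associated with the free generators of $\mathbb{F}_n$. $L^\infty[-1,1]$ carries the trace given by normalized Lebesgue measure (for instance $u_i$ may be identified with $x \mapsto e^{i\pi x}$, in which case $u_i + u_i^*$ becomes $2\cos(\pi x)$, which generates the even functions). $S''$ denotes the von Neumann algebra generated by $S$. The radial MASA is $A_r = \{\sum_{i=1}^n (u_i + u_i^* )\}''$. A unitary $v$ is freely independent of $A_r$ if the von Neumann algebras $\{v\}''$ and $A_r$ are freely independent with respect to $\tau$. *)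

theory Defs
  imports "HOL-Analysis.Analysis"
begin

section \<open>Free groups\<close>

text \<open>A letter is a generator together with a sign; \<open>(a, True)\<close> is the generator \<open>a\<close> and
  \<open>(a, False)\<close> its inverse. The free group is realised on reduced words.\<close>

definition inv_letter :: "'n \<times> bool \<Rightarrow> 'n \<times> bool" where
  "inv_letter x = (fst x, \<not> snd x)"

definition reduced :: "('n \<times> bool) list \<Rightarrow> bool" where
  "reduced = successively (\<lambda>x y. y \<noteq> inv_letter x)"

text \<open>Left multiplication of a reduced word by a letter.\<close>

definition push :: "'n \<times> bool \<Rightarrow> ('n \<times> bool) list \<Rightarrow> ('n \<times> bool) list" where
  "push x w = (if w \<noteq> [] \<and> hd w = inv_letter x then tl w else x # w)"

lemma inv_letter_inv_letter [simp]: "inv_letter (inv_letter x) = x"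
  by (simp add: inv_letter_def)

lemma inv_letter_neq [simp]: "inv_letter x \<noteq> x" "x \<noteq> inv_letter x"
  by (auto simp: inv_letter_def prod_eq_iff)

lemma reduced_Nil [simp]: "reduced []"
  by (simp add: reduced_def)

lemma reduced_Cons: "reduced (x # w) \<longleftrightarrow> w = [] \<or> hd w \<noteq> inv_letter x \<and> reduced w"
  by (auto simp: reduced_def successively_Cons)

lemma reduced_push: "reduced w \<Longrightarrow> reduced (push x w)"
  by (cases w) (auto simp: push_def reduced_Cons)

lemma push_push_inv: "reduced w \<Longrightarrow> push (inv_letter x) (push x w) = w"
  by (cases w) (auto simp: push_def reduced_Cons)

lemma push_inv_push: "reduced w \<Longrightarrow> push x (push (inv_letter x) w) = w"
  using push_push_inv[of w "inv_letter x"] by simp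

lemma reduced_foldr_push: "reduced w \<Longrightarrow> reduced (foldr push v w)"
  by (induction v) (auto intro: reduced_push)

lemma foldr_push_push:
  assumes "reduced w" "reduced v"
  shows "foldr push (push x v) w = push x (foldr push v w)"
proof (cases "v \<noteq> [] \<and> hd v = inv_letter x")
  case True
  then obtain v' where v: "v = inv_letter x # v'" by (cases v) auto
  then show ?thesis
    using push_inv_push[OF reduced_foldr_push[OF assms(1)], of x v'] by (simp add: push_def)
qed (auto simp: push_def)

lemma foldr_push_foldr_push:
  assumes "reduced w" "reduced v"
  shows "foldr push (foldr push u v) w = foldr push u (foldr push v w)"
  by (induction u) (auto simp: foldr_push_push reduced_foldr_push assms)

lemma foldr_push_Nil: "reduced w \<Longrightarrow> foldr push w [] = w"
  by (induction w) (auto simp: reduced_Cons push_def)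

lemma reduced_inverse: "reduced w \<Longrightarrow> reduced (map inv_letter (rev w))"
  unfolding reduced_def successively_map successively_rev
  by (erule successively_mono) (metis inv_letter_inv_letter)+

lemma foldr_push_inverse:
  "reduced v \<Longrightarrow> foldr push (map inv_letter (rev w)) (foldr push w v) = v"
  by (induction w) (auto simp: push_push_inv reduced_foldr_push)

typedef 'n free_group = "{w :: ('n \<times> bool) list. reduced w}"
  by (rule exI[of _ "[]"]) simp

setup_lifting type_definition_free_group

instantiation free_group :: (type) "{monoid_mult, inverse}"
begin

lift_definition one_free_group :: "'a free_group" is "[]" by simp

lift_definition times_free_group :: "'a free_group \<Rightarrow> 'a free_group \<Rightarrow> 'a free_group"
  is "\<lambda>v w. foldr push v w" by (rule reduced_foldr_push)

lift_definition inverse_free_group :: "'a free_group \<Rightarrow> 'a free_group"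
  is "\<lambda>w. map inv_letter (rev w)" by (rule reduced_inverse)

definition divide_free_group :: "'a free_group \<Rightarrow> 'a free_group \<Rightarrow> 'a free_group" where
  "divide_free_group g h = g * inverse h"

instance
  by standard (transfer; simp add: foldr_push_foldr_push foldr_push_Nil)+

end

lemma free_group_left_inverse: "inverse g * g = (1 :: 'n free_group)"
proof transfer
  fix w :: "('n \<times> bool) list" assume "reduced w"
  then show "foldr push (map inv_letter (rev w)) w = []"
    using foldr_push_inverse[of "[]" w] by (simp add: foldr_push_Nil)
qed

lemma free_group_right_inverse: "g * inverse g = (1 :: 'n free_group)"
  by (metis free_group_left_inverse mult.assoc mult_1_left)

lift_definition generator :: "'n \<Rightarrow> 'n free_group" is "\<lambda>i. [(i, True)]"
  by (simp add: reduced_Cons)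

lifting_forget free_group.lifting


section \<open>The Hilbert space of square-summable functions\<close>

typedef 'a ell2 = "{f :: 'a \<Rightarrow> complex. (\<lambda>x. (cmod (f x))\<^sup>2) summable_on UNIV}"
  morphisms ell2_apply Abs_ell2
  by (rule exI[of _ "\<lambda>_. 0"]) simp

setup_lifting type_definition_ell2

lemma ell2_prod_abs_summable:
  fixes f g :: "'a \<Rightarrow> complex"
  assumes "(\<lambda>x. (cmod (f x))\<^sup>2) summable_on UNIV" "(\<lambda>x. (cmod (g x))\<^sup>2) summable_on UNIV"
  shows "(\<lambda>x. norm (f x * g x)) summable_on UNIV"
  by (rule abs_summable_product) (use assms in \<open>simp_all add: norm_mult power2_eq_square\<close>)

lemma ell2_prod_summable:
  fixes f g :: "'a \<Rightarrow> complex"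
  assumes "(\<lambda>x. (cmod (f x))\<^sup>2) summable_on UNIV" "(\<lambda>x. (cmod (g x))\<^sup>2) summable_on UNIV"
  shows "(\<lambda>x. cnj (f x) * g x) summable_on UNIV"
  by (rule abs_summable_summable, rule ell2_prod_abs_summable) (use assms in simp_all)

lemma ell2_add_summable:
  fixes f g :: "'a \<Rightarrow> complex"
  assumes "(\<lambda>x. (cmod (f x))\<^sup>2) summable_on UNIV" "(\<lambda>x. (cmod (g x))\<^sup>2) summable_on UNIV"
  shows "(\<lambda>x. (cmod (f x + g x))\<^sup>2) summable_on UNIV"
proof (rule summable_on_comparison_test)
  show "(\<lambda>x. 2 * (cmod (f x))\<^sup>2 + 2 * (cmod (g x))\<^sup>2) summable_on UNIV"
    by (intro summable_on_add summable_on_cmult_right assms)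
  fix x
  have "(cmod (f x + g x))\<^sup>2 \<le> (cmod (f x) + cmod (g x))\<^sup>2"
    by (simp add: norm_triangle_ineq power_mono)
  also have "\<dots> \<le> 2 * (cmod (f x))\<^sup>2 + 2 * (cmod (g x))\<^sup>2"
    using sum_squares_bound[of "cmod (f x)" "cmod (g x)"] by (simp add: power2_sum)
  finally show "(cmod (f x + g x))\<^sup>2 \<le> 2 * (cmod (f x))\<^sup>2 + 2 * (cmod (g x))\<^sup>2" .
qed auto

lift_definition scaleC :: "complex \<Rightarrow> 'a ell2 \<Rightarrow> 'a ell2" is "\<lambda>c f x. c * f x"
  by (simp add: norm_mult power_mult_distrib summable_on_cmult_right)

text \<open>The inner product is conjugate-linear in its first argument.\<close>

lift_definition cinner :: "'a ell2 \<Rightarrow> 'a ell2 \<Rightarrow> complex"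
  is "\<lambda>f g. \<Sum>\<^sub>\<infinity>x. cnj (f x) * g x" .

lift_definition delta :: "'a \<Rightarrow> 'a ell2" is "\<lambda>a x. if x = a then 1 else 0"
proof -
  fix a :: 'a
  have "(\<lambda>x. (cmod (if x = a then 1 else 0))\<^sup>2) summable_on {a}"
    by simp
  then show "(\<lambda>x. (cmod (if x = a then 1 else 0))\<^sup>2) summable_on UNIV"
    by (rule summable_on_cong_neutral[THEN iffD1, rotated -1]) auto
qed

text \<open>The real structure below comes from the complex Hilbert space structure; in particular the
  norm is the Hilbert space norm, so that bounded operators are available as
  \<^typ>\<open>'a ell2 \<Rightarrow>\<^sub>L 'a ell2\<close>, up to complex linearity.\<close>

instantiation ell2 :: (type) real_inner
begin

lift_definition zero_ell2 :: "'a ell2" is "\<lambda>_. 0" by simp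

lift_definition plus_ell2 :: "'a ell2 \<Rightarrow> 'a ell2 \<Rightarrow> 'a ell2" is "\<lambda>f g x. f x + g x"
  by (rule ell2_add_summable)

lift_definition uminus_ell2 :: "'a ell2 \<Rightarrow> 'a ell2" is "\<lambda>f x. - f x" by simp

definition minus_ell2 :: "'a ell2 \<Rightarrow> 'a ell2 \<Rightarrow> 'a ell2" where
  "minus_ell2 f g = f + (- g)"

definition scaleR_ell2 :: "real \<Rightarrow> 'a ell2 \<Rightarrow> 'a ell2" where
  "scaleR_ell2 r = scaleC (of_real r)"

definition inner_ell2 :: "'a ell2 \<Rightarrow> 'a ell2 \<Rightarrow> real" where
  "inner_ell2 f g = Re (cinner f g)"

definition norm_ell2 :: "'a ell2 \<Rightarrow> real" where
  "norm_ell2 f = sqrt (inner f f)"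

definition sgn_ell2 :: "'a ell2 \<Rightarrow> 'a ell2" where
  "sgn_ell2 f = scaleR (inverse (norm f)) f"

definition dist_ell2 :: "'a ell2 \<Rightarrow> 'a ell2 \<Rightarrow> real" where
  "dist_ell2 f g = norm (f - g)"

definition uniformity_ell2 :: "('a ell2 \<times> 'a ell2) filter" where
  "uniformity_ell2 = (INF e\<in>{0<..}. principal {(x, y). dist x y < e})"

definition open_ell2 :: "'a ell2 set \<Rightarrow> bool" where
  "open_ell2 U \<longleftrightarrow> (\<forall>x\<in>U. eventually (\<lambda>(x', y). x' = x \<longrightarrow> y \<in> U) uniformity)"

lemma ell2_apply_simps:
  "ell2_apply 0 x = 0"
  "ell2_apply (f + g) x = ell2_apply f x + ell2_apply g x"
  "ell2_apply (- f) x = - ell2_apply f x"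
  "ell2_apply (f - g) x = ell2_apply f x - ell2_apply g x"
  "ell2_apply (scaleC c f) x = c * ell2_apply f x"
  "ell2_apply (scaleR r f) x = of_real r * ell2_apply f x"
  unfolding minus_ell2_def scaleR_ell2_def by (transfer; simp)+

lemma ell2_eqI: "(\<And>x. ell2_apply f x = ell2_apply g x) \<Longrightarrow> f = g"
  by (metis ell2_apply_inject ext)

lemma cinner_commute: "cinner f g = cnj (cinner g f)"
  by transfer (simp flip: infsum_cnj add: mult.commute)

lemma cinner_add_left: "cinner (f + g) h = cinner f h + cinner g h"
  by transfer (simp add: distrib_right infsum_add ell2_prod_summable)

lemma cinner_scaleC_left: "cinner (scaleC c f) g = cnj c * cinner f g"
  by transfer (simp add: mult.assoc infsum_cmult_right')

lemma ell2_summable: "(\<lambda>x. (cmod (ell2_apply f x))\<^sup>2) summable_on UNIV"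
  using ell2_apply[of f] by simp

lemma inner_ell2_self: "inner f f = (\<Sum>\<^sub>\<infinity>x. (cmod (ell2_apply f x))\<^sup>2)"
  unfolding inner_ell2_def cinner.rep_eq
    infsum_Re[OF ell2_prod_summable[OF ell2_summable ell2_summable], symmetric]
  by (rule infsum_cong) (simp add: cmod_power2 flip: power2_eq_square)

instance
proof
  fix f g h :: "'a ell2" and r s :: real
  show "f + g + h = f + (g + h)" "f + g = g + f" "0 + f = f" "- f + f = 0" "f - g = f + - g"
    "r *\<^sub>R (f + g) = r *\<^sub>R f + r *\<^sub>R g" "(r + s) *\<^sub>R f = r *\<^sub>R f + s *\<^sub>R f"
    "r *\<^sub>R s *\<^sub>R f = (r * s) *\<^sub>R f" "1 *\<^sub>R f = f"
    by (rule ell2_eqI, simp add: ell2_apply_simps algebra_simps)+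
  show "sgn f = inverse (norm f) *\<^sub>R f" by (simp add: sgn_ell2_def)
  show "dist f g = norm (f - g)" by (simp add: dist_ell2_def)
  show "uniformity = (INF e\<in>{0<..}. principal {(x, y :: 'a ell2). dist x y < e})"
    by (simp add: uniformity_ell2_def)
  show "open U \<longleftrightarrow> (\<forall>x\<in>U. eventually (\<lambda>(x', y). x' = x \<longrightarrow> y \<in> U) uniformity)"
    for U :: "'a ell2 set" by (simp add: open_ell2_def)
  show "inner f g = inner g f"
    unfolding inner_ell2_def by (subst cinner_commute) simp
  show "inner (f + g) h = inner f h + inner g h"
    by (simp add: inner_ell2_def cinner_add_left)
  show "inner (r *\<^sub>R f) g = r * inner f g"
    by (simp add: inner_ell2_def scaleR_ell2_def cinner_scaleC_left)
  show "0 \<le> inner f f"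
    by (simp add: inner_ell2_self infsum_nonneg)
  show "inner f f = 0 \<longleftrightarrow> f = 0"
  proof
    assume "inner f f = 0"
    then have "(cmod (ell2_apply f x))\<^sup>2 = 0" for x
      unfolding inner_ell2_self
      by (intro nonneg_infsum_le_0D[where A = UNIV and f = "\<lambda>x. (cmod (ell2_apply f x))\<^sup>2"])
        (use ell2_summable[of f] in auto)
    then show "f = 0" by (intro ell2_eqI) (simp add: ell2_apply_simps)
  next
    assume "f = 0"
    then show "inner f f = 0" by (simp add: inner_ell2_self ell2_apply_simps)
  qed
  show "norm f = sqrt (inner f f)" by (simp add: norm_ell2_def)
qed

end

lemma norm_ell2_eq: "norm f = sqrt (\<Sum>\<^sub>\<infinity>x. (cmod (ell2_apply f x))\<^sup>2)"
  by (simp add: norm_ell2_def inner_ell2_self)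


section \<open>Bounded operators and von Neumann algebras\<close>

type_synonym 'a ell2_op = "'a ell2 \<Rightarrow>\<^sub>L 'a ell2"

lemma norm_scaleC: "norm (scaleC c f) = cmod c * norm f"
  by (simp add: norm_ell2_eq ell2_apply_simps norm_mult power_mult_distrib infsum_cmult_right'
      real_sqrt_mult)

lift_definition scalar_op :: "complex \<Rightarrow> 'a ell2_op" is scaleC
proof (rule bounded_linear_intro)
  fix c :: complex and f g :: "'a ell2" and r :: real
  show "scaleC c (f + g) = scaleC c f + scaleC c g" "scaleC c (r *\<^sub>R f) = r *\<^sub>R scaleC c f"
    by (rule ell2_eqI, simp add: ell2_apply_simps algebra_simps)+
  show "norm (scaleC c f) \<le> norm f * cmod c" by (simp add: norm_scaleC)
qed

text \<open>The algebra \<open>B(H)\<close> of bounded complex-linear operators.\<close>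

definition bounded_ops :: "'a ell2_op set" where
  "bounded_ops = {T. \<forall>c f. blinfun_apply T (scaleC c f) = scaleC c (blinfun_apply T f)}"

definition adj :: "'a ell2_op \<Rightarrow> 'a ell2_op" where
  "adj T = (THE S. \<forall>f g. cinner (blinfun_apply S f) g = cinner f (blinfun_apply T g))"

definition unitary_op :: "'a ell2_op \<Rightarrow> bool" where
  "unitary_op T \<longleftrightarrow> T \<in> bounded_ops \<and> adj T o\<^sub>L T = id_blinfun \<and> T o\<^sub>L adj T = id_blinfun"

definition commutant :: "'a ell2_op set \<Rightarrow> 'a ell2_op set" where
  "commutant S = {T \<in> bounded_ops. \<forall>R\<in>S. T o\<^sub>L R = R o\<^sub>L T}"

text \<open>The von Neumann algebra generated by a set of operators is the bicommutant of its
  self-adjoint closure.\<close>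

definition vN_generated :: "'a ell2_op set \<Rightarrow> 'a ell2_op set" where
  "vN_generated S = commutant (commutant (S \<union> adj ` S))"


section \<open>The free group factor\<close>

lemma bij_left_mult_inverse: "bij (\<lambda>h. inverse g * h :: 'n free_group)"
proof (rule bij_betw_byWitness[where f' = "\<lambda>h. g * h"])
  show "\<forall>h\<in>UNIV. g * (inverse g * h) = h" "\<forall>h\<in>UNIV. inverse g * (g * h) = h"
    by (simp_all flip: mult.assoc add: free_group_left_inverse free_group_right_inverse)
qed auto

lift_definition left_translate :: "'n free_group \<Rightarrow> 'n free_group ell2 \<Rightarrow> 'n free_group ell2"
  is "\<lambda>g f h. f (inverse g * h)"
proof -
  fix g :: "'n free_group" and f :: "'n free_group \<Rightarrow> complex"
  assume "(\<lambda>x. (cmod (f x))\<^sup>2) summable_on UNIV"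
  then show "(\<lambda>x. (cmod (f (inverse g * x)))\<^sup>2) summable_on UNIV"
    using summable_on_reindex_bij_betw[OF bij_left_mult_inverse, of "\<lambda>x. (cmod (f x))\<^sup>2" g] by simp
qed

lemma norm_left_translate: "norm (left_translate g f) = norm f"
  unfolding norm_ell2_eq left_translate.rep_eq
  using infsum_reindex_bij_betw[OF bij_left_mult_inverse, of "\<lambda>x. (cmod (ell2_apply f x))\<^sup>2" g]
  by simp

text \<open>The left regular representation.\<close>

lift_definition left_regular :: "'n free_group \<Rightarrow> 'n free_group ell2_op" is left_translate
proof (rule bounded_linear_intro)
  fix g :: "'n free_group" and f f' :: "'n free_group ell2" and r :: real
  show "left_translate g (f + f') = left_translate g f + left_translate g f'"
    "left_translate g (r *\<^sub>R f) = r *\<^sub>R left_translate g f"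
    by (rule ell2_eqI, simp add: ell2_apply_simps left_translate.rep_eq)+
  show "norm (left_translate g f) \<le> norm f * 1" by (simp add: norm_left_translate)
qed

definition free_group_factor :: "'n free_group ell2_op set" where
  "free_group_factor = vN_generated (range left_regular)"

definition canonical_trace :: "'n free_group ell2_op \<Rightarrow> complex" where
  "canonical_trace T = cinner (delta 1) (blinfun_apply T (delta 1))"

definition gen_unitary :: "'n \<Rightarrow> 'n free_group ell2_op" where
  "gen_unitary i = left_regular (generator i)"

definition gen_algebra :: "'n \<Rightarrow> 'n free_group ell2_op set" where
  "gen_algebra i = vN_generated {gen_unitary i}"

definition gen_real_algebra :: "'n \<Rightarrow> 'n free_group ell2_op set" where
  "gen_real_algebra i = vN_generated {gen_unitary i + adj (gen_unitary i)}"

definition radial_masa :: "'n::finite free_group ell2_op set" where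
  "radial_masa = vN_generated {\<Sum>i\<in>UNIV. gen_unitary i + adj (gen_unitary i)}"


section \<open>Free independence\<close>

text \<open>A family of subalgebras \<open>A i\<close>, \<open>i \<in> I\<close>, of \<open>M\<close> is freely independent with respect to
  \<open>tr\<close> if every nonempty alternating product of trace-zero elements has trace zero.\<close>

definition freely_independent ::
    "'a ell2_op set \<Rightarrow> ('a ell2_op \<Rightarrow> complex) \<Rightarrow> 'i set \<Rightarrow> ('i \<Rightarrow> 'a ell2_op set) \<Rightarrow> bool" where
  "freely_independent M tr I A \<longleftrightarrow>
     (\<forall>i\<in>I. A i \<subseteq> M) \<and>
     (\<forall>is as. is \<noteq> [] \<and> length as = length is \<and> distinct_adj is \<and>
        (\<forall>k<length is. is ! k \<in> I \<and> as ! k \<in> A (is ! k) \<and> tr (as ! k) = 0) \<longrightarrow>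
        tr (foldr (o\<^sub>L) as id_blinfun) = 0)"

definition unitary_free_from :: "'n free_group ell2_op \<Rightarrow> 'n free_group ell2_op set \<Rightarrow> bool" where
  "unitary_free_from v B \<longleftrightarrow> unitary_op v \<and>
     freely_independent free_group_factor canonical_trace UNIV
       (\<lambda>b::bool. if b then vN_generated {v} else B)"


section \<open>Identification with essentially bounded functions on the interval\<close>

definition interval_measure :: "real measure" where
  "interval_measure = uniform_measure (lebesgue_on {-1..1}) {-1..1}"

text \<open>Representatives of the elements of \<open>L\<^sup>\<infinity>[-1,1]\<close>; equality there is equality almost
  everywhere.\<close>

definition Linf :: "(real \<Rightarrow> complex) set" where
  "Linf = {f \<in> borel_measurable interval_measure. \<exists>C. AE x in interval_measure. cmod (f x) \<le> C}"

definition Linf_even :: "(real \<Rightarrow> complex) set" where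
  "Linf_even = {f \<in> Linf. AE x in interval_measure. f (- x) = f x}"

text \<open>A trace-preserving \<open>*\<close>-isomorphism from \<open>L\<^sup>\<infinity>[-1,1]\<close> onto \<open>A\<close>, as a map on
  representatives: the first clause says that it is well defined and injective on classes.\<close>

definition Linf_isomorphism ::
    "((real \<Rightarrow> complex) \<Rightarrow> 'n free_group ell2_op) \<Rightarrow> 'n free_group ell2_op set \<Rightarrow> bool" where
  "Linf_isomorphism \<Phi> A \<longleftrightarrow>
     (\<forall>f\<in>Linf. \<forall>g\<in>Linf. \<Phi> f = \<Phi> g \<longleftrightarrow> (AE x in interval_measure. f x = g x)) \<and>
     \<Phi> ` Linf = A \<and>
     (\<forall>f\<in>Linf. \<forall>g\<in>Linf. \<Phi> (\<lambda>x. f x + g x) = \<Phi> f + \<Phi> g) \<and>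
     (\<forall>f\<in>Linf. \<forall>g\<in>Linf. \<Phi> (\<lambda>x. f x * g x) = \<Phi> f o\<^sub>L \<Phi> g) \<and>
     (\<forall>c. \<forall>f\<in>Linf. \<Phi> (\<lambda>x. c * f x) = scalar_op c o\<^sub>L \<Phi> f) \<and>
     (\<forall>f\<in>Linf. \<Phi> (\<lambda>x. cnj (f x)) = adj (\<Phi> f)) \<and>
     (\<forall>f\<in>Linf. canonical_trace (\<Phi> f) = (LINT x|interval_measure. f x))"

end

(* Write A_i = B_i + w_i B_i, where w_i is a self-adjoint unitary commuting with B_i and w_i B_i has
   trace zero. In an alternating product of nonzero powers of v = w_i w_j and of alternating words in
   centered elements of the B_k, two letters from B_k are always separated by a full factor w_i w_j or
   w_j w_i unless they belong to the same word. Hence the maximal groups of adjacent letters with equal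
   index are of the form w, c, w c, c w or w c w = c with c centered in B_k. All of these are centered in
   A_k, so the product is an alternating centered word in the free algebras A_k and has trace zero. Thus
   v is free from the algebra generated by all the B_k, which contains the radial MASA. *)

theory Submission
  imports Defs
begin

section \<open>Hilbert spaces\<close>

text \<open>An element of a bicommutant is known only by what it commutes with, while the regrouping
  speaks of words in explicit generators. The bridge is the vector \<open>delta 1\<close>. By
  traciality the trace of a word depends on a single letter \<open>a\<close>, the others being
  fixed, only through \<open>a\<close> applied to \<open>delta 1\<close>, and continuously in that
  vector. Letters are therefore replaced one at a time, and for each it suffices that this vector
  lies in the closed span of \<open>delta 1\<close> and the vectors of a suitable family. That
  membership holds because the projection onto a closed subspace invariant under the generators and
  their adjoints lies in the commutant. The family may lie outside the algebra that it approximates: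
  words in the centered parts of the B_k serve for the radial MASA. The reduction is made twice:
  from the A_k to nonzero powers of u_k, where freeness means that concatenated reduced words do not
  cancel, and from {v}'' and the radial MASA to powers of v and words in the B_k, where regrouping
  produces general centered elements of the A_k.\<close>

lemma exists_orthogonal_projection:
  fixes x :: "'a::{real_inner, complete_space}"
  assumes "subspace K" "closed K"
  shows "\<exists>y\<in>K. \<forall>z\<in>K. inner (x - y) z = 0"
proof -
  have ne: "K \<noteq> {}" using assms(1) subspace_0 by blast
  define d where "d = infdist x K"
  have d_le: "d \<le> dist x z" if "z \<in> K" for z
    using that by (simp add: d_def infdist_le)
  have d0: "d \<ge> 0" by (simp add: d_def infdist_nonneg)
  have "\<exists>y\<in>K. dist x y < d + 1 / real (Suc n)" for n
  proof (rule ccontr)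
    assume "\<not> ?thesis"
    then have "d + 1 / real (Suc n) \<le> infdist x K"
      using ne by (auto simp: infdist_def intro!: cINF_greatest)
    then show False by (simp add: d_def)
  qed
  then obtain y where yK: "\<And>n. y n \<in> K" and yd: "\<And>n. dist x (y n) < d + 1 / real (Suc n)"
    by metis
  define e where "e n = 1 / real (Suc n)" for n
  have e: "0 \<le> e n" "e n \<le> 1" for n by (auto simp: e_def)
  \<comment> \<open>\<open>e n \<le> 1\<close> absorbs the quadratic term, so that the error is
    linear in \<open>e n\<close>.\<close>
  have sq: "(dist x (y n))\<^sup>2 \<le> d\<^sup>2 + (2 * d + 1) * e n" for n
  proof -
    have "(dist x (y n))\<^sup>2 \<le> (d + e n)\<^sup>2"
      using yd[of n] by (intro power_mono) (auto simp: e_def)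
    also have "\<dots> = d\<^sup>2 + 2 * d * e n + e n * e n" by (simp add: power2_eq_square algebra_simps)
    also have "e n * e n \<le> 1 * e n" using e by (intro mult_right_mono) auto
    finally show ?thesis by (simp add: algebra_simps)
  qed
  \<comment> \<open>The midpoint of \<open>y m\<close> and \<open>y n\<close> lies in
    \<open>K\<close>, hence at distance at least \<open>d\<close> from \<open>x\<close>; the
    parallelogram law then forces the two points together.\<close>
  have par: "(dist (y m) (y n))\<^sup>2 \<le> 2 * (2 * d + 1) * (e m + e n)" for m n
  proof -
    define p where "p = (1/2) *\<^sub>R (y m + y n)"
    have "p \<in> K" unfolding p_def by (intro subspace_scale subspace_add assms yK)
    then have "d \<le> norm (x - p)" using d_le[of p] by (simp add: dist_norm)
    then have "d\<^sup>2 \<le> (norm (x - p))\<^sup>2" using d0 by (intro power_mono)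
    moreover have "4 * (norm (x - p))\<^sup>2 + (norm (y m - y n))\<^sup>2
        = 2 * (norm (x - y m))\<^sup>2 + 2 * (norm (x - y n))\<^sup>2"
      unfolding p_def power2_norm_eq_inner
      by (simp add: inner_diff_left inner_diff_right inner_add_left inner_add_right
          inner_commute algebra_simps)
    ultimately show ?thesis using sq[of m] sq[of n] by (simp add: dist_norm algebra_simps)
  qed
  have "Cauchy y"
  proof (rule metric_CauchyI)
    fix r :: real assume r: "r > 0"
    define C where "C = 4 * (2 * d + 1)"
    have C: "C > 0" using d0 by (simp add: C_def)
    have "r\<^sup>2 / C > 0" using r C by simp
    then obtain N where N: "e N < r\<^sup>2 / C"
      using nat_approx_posE unfolding e_def by metis
    have "dist (y m) (y n) < r" if "m \<ge> N" "n \<ge> N" for m n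
    proof -
      have "e m \<le> e N" "e n \<le> e N"
        using that by (auto simp: frac_le e_def)
      then have "2 * (2 * d + 1) * (e m + e n) \<le> 2 * (2 * d + 1) * (e N + e N)"
        using d0 by (intro mult_left_mono) auto
      also have "\<dots> = C * e N" by (simp add: C_def algebra_simps)
      also have "\<dots> < C * (r\<^sup>2 / C)" using N C by (intro mult_strict_left_mono)
      also have "\<dots> = r\<^sup>2" using C by simp
      finally have "(dist (y m) (y n))\<^sup>2 < r\<^sup>2" using par[of m n] by linarith
      then show ?thesis using r power_less_imp_less_base less_imp_le by blast
    qed
    then show "\<exists>N. \<forall>m\<ge>N. \<forall>n\<ge>N. dist (y m) (y n) < r" by blast
  qed
  then obtain l where l: "y \<longlonglongrightarrow> l" using Cauchy_convergent_iff convergent_def by blast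
  have lK: "l \<in> K" using closed_sequentially[OF assms(2)] yK l by blast
  have "(\<lambda>n. dist x (y n)) \<longlonglongrightarrow> dist x l" by (intro tendsto_intros l)
  moreover have "(\<lambda>n. d + 1 / real (Suc n)) \<longlonglongrightarrow> d + 0"
    by (intro tendsto_intros LIMSEQ_Suc[OF lim_1_over_n])
  ultimately have "dist x l \<le> d + 0"
    by (rule LIMSEQ_le) (use yd less_imp_le in blast)
  then have ld: "norm (x - l) \<le> d" by (simp add: dist_norm)
  have "inner (x - l) z = 0" if z: "z \<in> K" for z
  proof (cases "z = 0")
    case False
    \<comment> \<open>The coefficient of the component of \<open>x - l\<close> along
      \<open>z\<close>: subtracting that component would shorten \<open>x - l\<close>, which the
      minimality of \<open>l\<close> forbids unless it is 0.\<close>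
    define t where "t = inner (x - l) z / inner z z"
    have zz: "inner z z > 0" using False by simp
    have "l + t *\<^sub>R z \<in> K" by (intro subspace_add subspace_scale assms lK z)
    then have "d \<le> norm (x - (l + t *\<^sub>R z))" using d_le[of "l + t *\<^sub>R z"] by (simp add: dist_norm)
    with ld have "norm (x - l) \<le> norm (x - l - t *\<^sub>R z)" by (simp add: algebra_simps)
    then have "(norm (x - l))\<^sup>2 \<le> (norm (x - l - t *\<^sub>R z))\<^sup>2" by (simp add: power_mono)
    also have "\<dots> = (norm (x - l))\<^sup>2 - 2 * t * inner (x - l) z + t * t * inner z z"
      unfolding power2_norm_eq_inner
      by (simp add: inner_diff_left inner_diff_right inner_commute algebra_simps)
    also have "t * t * inner z z = t * inner (x - l) z" using zz by (simp add: t_def)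
    finally have "t * inner (x - l) z \<le> 0" by simp
    then have "(inner (x - l) z)\<^sup>2 \<le> 0"
      using zz by (simp add: t_def power2_eq_square divide_le_0_iff)
    then show ?thesis by simp
  qed simp
  with lK show ?thesis by blast
qed

definition proj :: "'a::{real_inner, complete_space} set \<Rightarrow> 'a \<Rightarrow> 'a" where
  "proj K x = (SOME y. y \<in> K \<and> (\<forall>z\<in>K. inner (x - y) z = 0))"

context
  fixes K :: "'a::{real_inner, complete_space} set"
  assumes K: "subspace K" "closed K"
begin

lemma proj_in: "proj K x \<in> K"
  and proj_orthogonal: "z \<in> K \<Longrightarrow> inner (x - proj K x) z = 0"
  using someI_ex[of "\<lambda>y. y \<in> K \<and> (\<forall>z\<in>K. inner (x - y) z = 0)"]
    exists_orthogonal_projection[OF K, of x] unfolding proj_def by blast+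

lemma proj_unique:
  assumes "y \<in> K" "\<And>z. z \<in> K \<Longrightarrow> inner (x - y) z = 0"
  shows "proj K x = y"
proof -
  have "proj K x - y \<in> K" by (intro subspace_diff K proj_in assms)
  then have "inner (x - y) (proj K x - y) = 0" "inner (x - proj K x) (proj K x - y) = 0"
    using assms(2) proj_orthogonal by blast+
  then have "inner (proj K x - y) (proj K x - y) = 0" by (simp add: inner_diff_left)
  then show ?thesis by simp
qed

lemma bounded_linear_proj: "bounded_linear (proj K)"
proof (rule bounded_linear_intro)
  fix x y :: 'a and r :: real
  show "proj K (x + y) = proj K x + proj K y"
    by (rule proj_unique)
      (use proj_orthogonal[of _ x] proj_orthogonal[of _ y] in
        \<open>auto intro!: subspace_add K proj_in simp: inner_diff_left inner_add_left\<close>)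
  show "proj K (r *\<^sub>R x) = r *\<^sub>R proj K x"
    by (rule proj_unique)
      (use proj_orthogonal[of _ x] in
        \<open>auto intro!: subspace_scale K proj_in simp: inner_diff_left\<close>)
  have "inner (x - proj K x) (proj K x) = 0" by (simp add: proj_orthogonal proj_in)
  then have "(norm (proj K x))\<^sup>2 = inner x (proj K x)"
    by (simp add: power2_norm_eq_inner inner_diff_left)
  also have "\<dots> \<le> norm x * norm (proj K x)" by (rule norm_cauchy_schwarz)
  finally have "norm (proj K x) * norm (proj K x) \<le> norm x * norm (proj K x)"
    by (simp add: power2_eq_square)
  then show "norm (proj K x) \<le> norm x * 1"
    by (cases "proj K x = 0") auto
qed

end

text \<open>Modulo the kernel of \<phi> the space is spanned by one vector, the component
  \<open>z\<close> of \<open>g0\<close> orthogonal to the kernel. A multiple of \<open>z\<close>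
  therefore represents \<phi>, and its value at \<open>z\<close> fixes the scaling.\<close>

lemma riesz_representation:
  fixes \<phi> :: "'a::{real_inner, complete_space} \<Rightarrow> real"
  assumes "bounded_linear \<phi>"
  shows "\<exists>u. \<forall>g. \<phi> g = inner u g"
proof (cases "\<forall>g. \<phi> g = 0")
  case True
  then show ?thesis by (intro exI[of _ 0]) simp
next
  case False
  then obtain g0 where g0: "\<phi> g0 \<noteq> 0" by blast
  interpret bounded_linear \<phi> by fact
  define K where "K = {g. \<phi> g = 0}"
  have K: "subspace K" "closed K"
    unfolding K_def
    by (auto simp: subspace_def zero add scaleR intro!: closed_Collect_eq continuous_intros
        linear_continuous_on[OF assms])
  define z where "z = g0 - proj K g0"
  have \<phi>z: "\<phi> z = \<phi> g0" using proj_in[OF K, of g0] by (simp add: z_def diff K_def)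
  then have z0: "z \<noteq> 0" using g0 zero by auto
  have "\<phi> g = inner ((\<phi> z / inner z z) *\<^sub>R z) g" for g
  proof -
    have "g - (\<phi> g / \<phi> z) *\<^sub>R z \<in> K" using g0 \<phi>z by (simp add: K_def diff scaleR)
    then have "inner z (g - (\<phi> g / \<phi> z) *\<^sub>R z) = 0"
      unfolding z_def by (rule proj_orthogonal[OF K])
    then show ?thesis using z0 g0 \<phi>z by (simp add: inner_diff_right field_simps)
  qed
  then show ?thesis by blast
qed

text \<open>Riesz representation gives the values vector by vector. Linearity follows from
  uniqueness of the representing vector, and the bound from pairing \<open>s x\<close> with itself
  and cancelling one factor \<open>norm (s x)\<close>.\<close>

lemma exists_real_adjoint:
  fixes T :: "'a::{real_inner, complete_space} \<Rightarrow>\<^sub>L 'a"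
  shows "\<exists>S :: 'a \<Rightarrow>\<^sub>L 'a. \<forall>f g. inner (blinfun_apply S f) g = inner f (blinfun_apply T g)"
proof -
  have "\<exists>u. \<forall>g. inner f (blinfun_apply T g) = inner u g" for f
    by (rule riesz_representation) (intro bounded_linear_intros)
  then obtain s where s: "\<And>f g. inner f (blinfun_apply T g) = inner (s f) g" by metis
  have eqI: "x = y" if "\<And>g. inner x g = inner y g" for x y :: 'a
    by (rule vector_eq_rdot[THEN iffD1]) (use that in \<open>simp add: inner_commute\<close>)
  have "bounded_linear s"
  proof (rule bounded_linear_intro)
    fix x y :: 'a and r :: real
    show "s (x + y) = s x + s y" by (rule eqI) (simp add: s[symmetric] inner_add_left)
    show "s (r *\<^sub>R x) = r *\<^sub>R s x" by (rule eqI) (simp add: s[symmetric])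
    have "(norm (s x))\<^sup>2 = inner x (blinfun_apply T (s x))" by (simp add: s power2_norm_eq_inner)
    also have "\<dots> \<le> norm x * norm (blinfun_apply T (s x))" by (rule norm_cauchy_schwarz)
    also have "\<dots> \<le> norm x * (norm T * norm (s x))"
      by (intro mult_left_mono norm_blinfun) auto
    finally have "norm (s x) * norm (s x) \<le> (norm x * norm T) * norm (s x)"
      by (simp add: power2_eq_square mult.assoc)
    then show "norm (s x) \<le> norm x * norm T"
      by (cases "s x = 0") auto
  qed
  then show ?thesis
    by (intro exI[of _ "Blinfun s"]) (simp add: bounded_linear_Blinfun_apply s)
qed

section \<open>Operators on square-summable functions\<close>

lemma norm_ell2_sq_le:
  assumes "\<And>F. finite F \<Longrightarrow> (\<Sum>x\<in>F. (cmod (ell2_apply f x))\<^sup>2) \<le> C\<^sup>2" "C \<ge> 0"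
  shows "norm f \<le> C"
proof -
  have "(\<Sum>\<^sub>\<infinity>x. (cmod (ell2_apply f x))\<^sup>2) \<le> C\<^sup>2"
    by (rule infsum_le_finite_sums[OF ell2_summable]) (use assms in auto)
  then show ?thesis unfolding norm_ell2_eq using assms(2) real_le_lsqrt by (simp add: infsum_nonneg)
qed

lemma sum_le_norm_ell2_sq:
  assumes "finite F"
  shows "(\<Sum>x\<in>F. (cmod (ell2_apply f x))\<^sup>2) \<le> (norm f)\<^sup>2"
proof -
  have "(\<Sum>x\<in>F. (cmod (ell2_apply f x))\<^sup>2) \<le> (\<Sum>\<^sub>\<infinity>x. (cmod (ell2_apply f x))\<^sup>2)"
    by (rule finite_sum_le_infsum[OF ell2_summable]) (use assms in auto)
  then show ?thesis unfolding norm_ell2_eq by (simp add: infsum_nonneg)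
qed

lemma cmod_ell2_apply_le: "cmod (ell2_apply f x) \<le> norm f"
  using sum_le_norm_ell2_sq[of "{x}" f] by (simp add: power_mono_iff)

instance ell2 :: (type) complete_space
proof
  fix X :: "nat \<Rightarrow> 'a ell2"
  assume C: "Cauchy X"
  have "Cauchy (\<lambda>n. ell2_apply (X n) x)" for x
  proof (rule metric_CauchyI)
    fix e :: real assume "e > 0"
    then obtain N where "\<forall>m\<ge>N. \<forall>n\<ge>N. dist (X m) (X n) < e" using metric_CauchyD[OF C] by blast
    moreover have "dist (ell2_apply (X m) x) (ell2_apply (X n) x) \<le> dist (X m) (X n)" for m n
      using cmod_ell2_apply_le[of "X m - X n" x] by (simp add: dist_norm ell2_apply_simps)
    ultimately show "\<exists>N. \<forall>m\<ge>N. \<forall>n\<ge>N. dist (ell2_apply (X m) x) (ell2_apply (X n) x) < e"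
      using le_less_trans by blast
  qed
  then obtain f where f: "\<And>x. (\<lambda>n. ell2_apply (X n) x) \<longlonglongrightarrow> f x"
    unfolding Cauchy_convergent_iff convergent_def by metis
  \<comment> \<open>The Cauchy bound is kept on finite partial sums, where it passes to the
    pointwise limit; letting the finite set vary then gives it for the whole norm.\<close>
  have fin: "(\<Sum>x\<in>F. (cmod (ell2_apply (X m) x - f x))\<^sup>2) \<le> e\<^sup>2"
    if "finite F" "\<And>n. n \<ge> N \<Longrightarrow> dist (X m) (X n) < e" for F m N e
  proof (rule LIMSEQ_le_const2)
    show "(\<lambda>n. \<Sum>x\<in>F. (cmod (ell2_apply (X m) x - ell2_apply (X n) x))\<^sup>2)
        \<longlonglongrightarrow> (\<Sum>x\<in>F. (cmod (ell2_apply (X m) x - f x))\<^sup>2)"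
      by (intro tendsto_intros f)
    have "(\<Sum>x\<in>F. (cmod (ell2_apply (X m) x - ell2_apply (X n) x))\<^sup>2) \<le> e\<^sup>2" if "n \<ge> N" for n
    proof -
      have "(\<Sum>x\<in>F. (cmod (ell2_apply (X m - X n) x))\<^sup>2) \<le> (dist (X m) (X n))\<^sup>2"
        unfolding dist_norm by (rule sum_le_norm_ell2_sq) fact
      also have "\<dots> \<le> e\<^sup>2" using that \<open>\<And>n. n \<ge> N \<Longrightarrow> dist (X m) (X n) < e\<close>[of n]
        by (intro power_mono) auto
      finally show ?thesis by (simp add: ell2_apply_simps)
    qed
    then show "\<exists>N. \<forall>n\<ge>N. (\<Sum>x\<in>F. (cmod (ell2_apply (X m) x - ell2_apply (X n) x))\<^sup>2) \<le> e\<^sup>2"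
      by blast
  qed
  obtain N0 where N0: "\<forall>m\<ge>N0. \<forall>n\<ge>N0. dist (X m) (X n) < 1"
    using metric_CauchyD[OF C, of 1] by auto
  \<comment> \<open>The difference from one fixed member of the sequence is square-summable; adding
    that member back shows the same for the limit.\<close>
  have "(\<lambda>x. (cmod (f x + - ell2_apply (X N0) x))\<^sup>2) summable_on UNIV"
  proof (rule nonneg_bdd_above_summable_on)
    show "bdd_above (sum (\<lambda>x. (cmod (f x + - ell2_apply (X N0) x))\<^sup>2) ` {F. F \<subseteq> UNIV \<and> finite F})"
      using fin[of _ N0 N0 1] N0 by (intro bdd_aboveI[of _ 1]) (auto simp: norm_minus_commute)
  qed simp
  from ell2_add_summable[OF this ell2_summable[of "X N0"]]
  have "(\<lambda>x. (cmod (f x))\<^sup>2) summable_on UNIV" by simp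
  then obtain g where g: "ell2_apply g = f" using ell2_apply_cases by blast
  have "X \<longlonglongrightarrow> g"
  proof (rule metric_LIMSEQ_I)
    fix e :: real assume e: "e > 0"
    then obtain N where N: "\<forall>m\<ge>N. \<forall>n\<ge>N. dist (X m) (X n) < e / 2"
      using metric_CauchyD[OF C, of "e/2"] by auto
    have "dist (X m) g < e" if "m \<ge> N" for m
    proof -
      have "norm (X m - g) \<le> e / 2"
        by (rule norm_ell2_sq_le)
          (use fin[of _ N m "e/2"] N that e in \<open>auto simp: ell2_apply_simps g\<close>)
      then show ?thesis using e by (simp add: dist_norm)
    qed
    then show "\<exists>N. \<forall>m\<ge>N. dist (X m) g < e" by blast
  qed
  then show "convergent X" by (auto simp: convergent_def)
qed

lemma scaleC_simps [simp]:
  "scaleC c (f + g) = scaleC c f + scaleC c g" "scaleC (c + d) f = scaleC c f + scaleC d f"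
  "scaleC c (scaleC d f) = scaleC (c * d) f" "scaleC 1 f = f" "scaleC 0 f = 0" "scaleC c 0 = 0"
  "scaleC c (f - g) = scaleC c f - scaleC c g" "scaleC c (- f) = - scaleC c f"
  "scaleC (- c) f = - scaleC c f"
  by (rule ell2_eqI, simp add: ell2_apply_simps algebra_simps)+

lemma cinner_add_right: "cinner f (g + h) = cinner f g + cinner f h"
  using cinner_commute[of f "g + h"] cinner_commute[of f g] cinner_commute[of f h]
  by (simp add: cinner_add_left)

lemma cinner_scaleC_right: "cinner f (scaleC c g) = c * cinner f g"
  using cinner_commute[of f "scaleC c g"] cinner_commute[of f g] by (simp add: cinner_scaleC_left)

text \<open>Putting the imaginary unit into the first slot turns the imaginary part into a real
  part. This carries continuity and orthogonality over from the real inner product.\<close>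

lemma cinner_eq_inner: "cinner f g = Complex (inner f g) (inner (scaleC \<i> f) g)"
  by (simp add: complex_eq_iff inner_ell2_def cinner_scaleC_left)

lemma cinner_zero_right [simp]: "cinner f 0 = 0"
  by (simp add: cinner_eq_inner complex_eq_iff)

lemma continuous_on_cinner [continuous_intros]:
  assumes "continuous_on A h"
  shows "continuous_on A (\<lambda>x. cinner f (h x))"
  unfolding cinner_eq_inner Complex_eq by (intro continuous_intros assms)

lemma cinner_eqI: "(\<And>h. cinner f h = cinner g h) \<Longrightarrow> f = g"
  using vector_eq_rdot[of f g] by (simp add: inner_ell2_def inner_commute)

lemma cinner_delta_left: "cinner (delta x) f = ell2_apply f x"
proof -
  have "cinner (delta x) f = (\<Sum>\<^sub>\<infinity>y. cnj (if y = x then 1 else 0) * ell2_apply f y)"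
    by (simp add: cinner.rep_eq delta.rep_eq)
  also have "\<dots> = (\<Sum>\<^sub>\<infinity>y\<in>{x}. ell2_apply f y)"
    by (rule infsum_cong_neutral) auto
  finally show ?thesis by simp
qed

lemma ell2_apply_delta: "ell2_apply (delta a) x = (if x = a then 1 else 0)"
  by (simp add: delta.rep_eq)

section \<open>Closed complex subspaces and closed spans\<close>

definition closed_csubspace :: "'a ell2 set \<Rightarrow> bool" where
  "closed_csubspace K \<longleftrightarrow> 0 \<in> K \<and> (\<forall>f\<in>K. \<forall>g\<in>K. f + g \<in> K) \<and> (\<forall>c. \<forall>f\<in>K. scaleC c f \<in> K) \<and> closed K"

text \<open>Encoded as an intersection, so that the span is used through its minimality: a property
  that cuts out a closed subspace is checked on \<open>X\<close> alone.\<close>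

definition closed_cspan :: "'a ell2 set \<Rightarrow> 'a ell2 set" where
  "closed_cspan X = \<Inter>{K. closed_csubspace K \<and> X \<subseteq> K}"

lemma closed_csubspace_subspace: "closed_csubspace K \<Longrightarrow> subspace K"
  by (auto simp: closed_csubspace_def subspace_def scaleR_ell2_def)

lemma closed_csubspace_closed_cspan: "closed_csubspace (closed_cspan X)"
  by (auto simp: closed_cspan_def closed_csubspace_def)

lemma closed_cspan_superset: "X \<subseteq> closed_cspan X"
  by (auto simp: closed_cspan_def)

lemma closed_cspan_least: "closed_csubspace K \<Longrightarrow> X \<subseteq> K \<Longrightarrow> closed_cspan X \<subseteq> K"
  by (auto simp: closed_cspan_def)

lemma closed_csubspaceD:
  assumes "closed_csubspace K"
  shows "0 \<in> K" "f \<in> K \<Longrightarrow> g \<in> K \<Longrightarrow> f + g \<in> K" "f \<in> K \<Longrightarrow> scaleC c f \<in> K" "closed K"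
  using assms by (auto simp: closed_csubspace_def)

lemma bounded_opsD: "T \<in> bounded_ops \<Longrightarrow> blinfun_apply T (scaleC c f) = scaleC c (blinfun_apply T f)"
  by (simp add: bounded_ops_def)

lemma closed_csubspace_vimage:
  assumes "T \<in> bounded_ops" "closed_csubspace K"
  shows "closed_csubspace {f. blinfun_apply T f \<in> K}"
proof -
  have "closed (blinfun_apply T -` K)"
    by (intro closed_vimage closed_csubspaceD(4)[OF assms(2)] continuous_intros)
  then show ?thesis
    using assms closed_csubspaceD[OF assms(2)]
    by (auto simp: closed_csubspace_def blinfun.add_right bounded_opsD vimage_def)
qed

text \<open>The kernel of a continuous linear functional. It serves with \<open>v = delta 1\<close>
  and \<open>c\<close> the pairing of \<open>u\<close> with \<open>delta 1\<close>, where the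
  functional pairs \<open>u\<close> with \<open>f\<close> minus its component along
  \<open>delta 1\<close>.\<close>

lemma closed_csubspace_functional_kernel:
  "closed_csubspace {f. cinner u f = cinner v f * c}"
  unfolding closed_csubspace_def
  by (auto simp: cinner_add_right cinner_scaleC_right algebra_simps
      intro!: closed_Collect_eq continuous_intros)

section \<open>Adjoints of bounded complex-linear operators\<close>

lemma cinner_adj_iff:
  "(\<forall>f g. cinner (blinfun_apply S f) g = cinner f (blinfun_apply T g)) \<longleftrightarrow> adj T = S"
  if T: "T \<in> bounded_ops" for S T :: "'a ell2_op"
proof -
  obtain R where R: "\<And>f g. inner (blinfun_apply R f) g = inner f (blinfun_apply T g)"
    using exists_real_adjoint by metis
  have Rc: "cinner (blinfun_apply R f) g = cinner f (blinfun_apply T g)" for f g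
  proof -
    \<comment> \<open>The real adjoint already works for \<open>cinner\<close>: \<open>c = 1\<close>
      compares the real parts and, as \<open>T\<close> is complex linear, the imaginary unit
      compares the imaginary parts.\<close>
    have "Re (cinner (blinfun_apply R f) (scaleC c g)) = Re (cinner f (blinfun_apply T (scaleC c g)))" for c
      using R[of f "scaleC c g"] by (simp add: inner_ell2_def)
    from this[of 1] this[of \<i>] show ?thesis
      by (simp add: bounded_opsD[OF T] cinner_scaleC_right complex_eq_iff)
  qed
  have unique: "S = R" if "\<forall>f g. cinner (blinfun_apply S f) g = cinner f (blinfun_apply T g)" for S
    by (rule blinfun_eqI, rule cinner_eqI) (simp add: that Rc)
  have "adj T = R" unfolding adj_def by (rule the_equality) (use Rc unique in auto)
  then show ?thesis using Rc unique by blast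
qed

lemma cinner_adj: "T \<in> bounded_ops \<Longrightarrow> cinner (blinfun_apply (adj T) f) g = cinner f (blinfun_apply T g)"
  using cinner_adj_iff by blast

lemma cinner_adj_right:
  "T \<in> bounded_ops \<Longrightarrow> cinner f (blinfun_apply (adj T) g) = cinner (blinfun_apply T f) g"
  using cinner_adj[of T g f] cinner_commute by metis

lemma adj_eqI:
  "T \<in> bounded_ops \<Longrightarrow> (\<And>f g. cinner (blinfun_apply S f) g = cinner f (blinfun_apply T g)) \<Longrightarrow> adj T = S"
  using cinner_adj_iff by blast

lemma adj_bounded_ops: "T \<in> bounded_ops \<Longrightarrow> adj T \<in> bounded_ops"
  unfolding bounded_ops_def
  by (auto intro!: cinner_eqI simp: cinner_adj[unfolded bounded_ops_def] cinner_scaleC_left)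

lemma bounded_ops_id: "id_blinfun \<in> bounded_ops"
  and bounded_ops_compose: "S \<in> bounded_ops \<Longrightarrow> T \<in> bounded_ops \<Longrightarrow> S o\<^sub>L T \<in> bounded_ops"
  and bounded_ops_add: "S \<in> bounded_ops \<Longrightarrow> T \<in> bounded_ops \<Longrightarrow> S + T \<in> bounded_ops"
  and bounded_ops_scalar: "scalar_op c \<in> bounded_ops"
  by (auto simp: bounded_ops_def blinfun.add_left scalar_op.rep_eq mult.commute)

lemma adj_adj: "T \<in> bounded_ops \<Longrightarrow> adj (adj T) = T"
  by (rule adj_eqI) (simp_all add: adj_bounded_ops cinner_adj_right)

lemma adj_compose:
  "S \<in> bounded_ops \<Longrightarrow> T \<in> bounded_ops \<Longrightarrow> adj (S o\<^sub>L T) = adj T o\<^sub>L adj S"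
  by (rule adj_eqI) (simp_all add: bounded_ops_compose cinner_adj)

lemma adj_add: "S \<in> bounded_ops \<Longrightarrow> T \<in> bounded_ops \<Longrightarrow> adj (S + T) = adj S + adj T"
  by (rule adj_eqI)
    (simp_all add: bounded_ops_add cinner_adj blinfun.add_left cinner_add_left cinner_add_right)

lemma scalar_op_compose: "T \<in> bounded_ops \<Longrightarrow> scalar_op c o\<^sub>L T = T o\<^sub>L scalar_op c"
  by (rule blinfun_eqI) (simp add: scalar_op.rep_eq bounded_opsD)

lemma blinfun_compose_add_left: "(S + T) o\<^sub>L R = (S o\<^sub>L R) + (T o\<^sub>L R)"
  and blinfun_compose_add_right: "R o\<^sub>L (S + T) = (R o\<^sub>L S) + (R o\<^sub>L T)"
  by (rule blinfun_eqI, simp add: blinfun.add_left blinfun.add_right)+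

lemma blinfun_compose_assoc: "(R o\<^sub>L S) o\<^sub>L T = R o\<^sub>L (S o\<^sub>L T)"
  by (rule blinfun_eqI) simp

lemma blinfun_compose_id [simp]: "id_blinfun o\<^sub>L T = T" "T o\<^sub>L id_blinfun = T"
  by (rule blinfun_eqI, simp)+

section \<open>Commutants and generated von Neumann algebras\<close>

lemma commutantD: "T \<in> commutant S \<Longrightarrow> R \<in> S \<Longrightarrow> T o\<^sub>L R = R o\<^sub>L T"
  and commutant_bounded_ops: "T \<in> commutant S \<Longrightarrow> T \<in> bounded_ops"
  by (auto simp: commutant_def)

lemma commutant_antimono: "S \<subseteq> T \<Longrightarrow> commutant T \<subseteq> commutant S"
  by (auto simp: commutant_def)

lemma subset_bicommutant: "S \<subseteq> bounded_ops \<Longrightarrow> S \<subseteq> commutant (commutant S)"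
  by (auto simp: commutant_def)

lemma commutant_id: "id_blinfun \<in> commutant S"
  by (simp add: commutant_def bounded_ops_id)

lemma commutant_compose: "T \<in> commutant S \<Longrightarrow> R \<in> commutant S \<Longrightarrow> T o\<^sub>L R \<in> commutant S"
  by (auto simp: commutant_def bounded_ops_compose)
    (metis blinfun_compose_assoc)

lemma commutant_add: "T \<in> commutant S \<Longrightarrow> R \<in> commutant S \<Longrightarrow> T + R \<in> commutant S"
  by (auto simp: commutant_def bounded_ops_add blinfun_compose_add_left blinfun_compose_add_right)

lemma commutant_scalar: "S \<subseteq> bounded_ops \<Longrightarrow> scalar_op c \<in> commutant S"
  by (auto simp: commutant_def bounded_ops_scalar scalar_op_compose)

lemma commutant_adj:
  assumes "S \<subseteq> bounded_ops" "adj ` S \<subseteq> S" "T \<in> commutant S"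
  shows "adj T \<in> commutant S"
proof -
  have T: "T \<in> bounded_ops" using assms(3) by (rule commutant_bounded_ops)
  have "adj T o\<^sub>L R = R o\<^sub>L adj T" if R: "R \<in> S" for R
  proof -
    have RS: "R \<in> bounded_ops" "adj R \<in> S" using assms R by auto
    have "adj (adj R o\<^sub>L T) = adj (T o\<^sub>L adj R)" using commutantD[OF assms(3) RS(2)] by simp
    then show ?thesis using RS T by (simp add: adj_compose adj_bounded_ops adj_adj)
  qed
  then show ?thesis using T by (simp add: commutant_def adj_bounded_ops)
qed

context
  fixes S :: "'a ell2_op set"
  assumes S: "S \<subseteq> bounded_ops"
begin

lemma self_adjoint_closure: "S \<union> adj ` S \<subseteq> bounded_ops" "adj ` (S \<union> adj ` S) \<subseteq> S \<union> adj ` S"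
  using S by (auto simp: adj_adj subset_iff intro: adj_bounded_ops)

lemma vN_generated_superset: "S \<subseteq> vN_generated S"
  using subset_bicommutant[OF self_adjoint_closure(1)] by (auto simp: vN_generated_def)

lemma vN_generated_adj:
  assumes "T \<in> vN_generated S" shows "adj T \<in> vN_generated S"
  unfolding vN_generated_def
proof (rule commutant_adj)
  show "commutant (S \<union> adj ` S) \<subseteq> bounded_ops" by (auto intro: commutant_bounded_ops)
  show "adj ` commutant (S \<union> adj ` S) \<subseteq> commutant (S \<union> adj ` S)"
    using commutant_adj[OF self_adjoint_closure] by blast
  show "T \<in> commutant (commutant (S \<union> adj ` S))" using assms by (simp add: vN_generated_def)
qed

text \<open>The commutant reverses inclusions, and whatever commutes with \<open>S\<close> and its
  adjoints already commutes with their whole bicommutant.\<close>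

lemma vN_generated_mono:
  assumes "T \<subseteq> vN_generated S" shows "vN_generated T \<subseteq> vN_generated S"
proof -
  have "T \<union> adj ` T \<subseteq> vN_generated S" using assms vN_generated_adj by blast
  then have "commutant (vN_generated S) \<subseteq> commutant (T \<union> adj ` T)" by (rule commutant_antimono)
  moreover have "commutant (S \<union> adj ` S) \<subseteq> commutant (vN_generated S)"
    unfolding vN_generated_def by (rule subset_bicommutant) (auto intro: commutant_bounded_ops)
  ultimately show ?thesis unfolding vN_generated_def[of T]
    by (metis (no_types) commutant_antimono order_trans vN_generated_def)
qed

end

lemma vN_generated_bounded_ops: "T \<in> vN_generated S \<Longrightarrow> T \<in> bounded_ops"
  by (auto simp: vN_generated_def intro: commutant_bounded_ops)

lemma vN_generated_id: "id_blinfun \<in> vN_generated S"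
  and vN_generated_compose:
    "T \<in> vN_generated S \<Longrightarrow> R \<in> vN_generated S \<Longrightarrow> T o\<^sub>L R \<in> vN_generated S"
  and vN_generated_add: "T \<in> vN_generated S \<Longrightarrow> R \<in> vN_generated S \<Longrightarrow> T + R \<in> vN_generated S"
  and vN_generated_scalar: "scalar_op c \<in> vN_generated S"
  unfolding vN_generated_def
  by (simp_all add: commutant_id commutant_compose commutant_add commutant_scalar subsetI commutant_bounded_ops)

text \<open>The orthogonal projection onto the invariant subspace lies in the commutant of \<open>S\<close>.\<close>

lemma vN_generated_invariant:
  assumes S: "S \<subseteq> bounded_ops" and K: "closed_csubspace K"
    and inv: "\<And>a f. a \<in> S \<Longrightarrow> f \<in> K \<Longrightarrow> blinfun_apply a f \<in> K"
    and inv_adj: "\<And>a f. a \<in> S \<Longrightarrow> f \<in> K \<Longrightarrow> blinfun_apply (adj a) f \<in> K"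
    and x: "x \<in> vN_generated S" and f: "f \<in> K"
  shows "blinfun_apply x f \<in> K"
proof -
  note K' = closed_csubspace_subspace[OF K] closed_csubspaceD(4)[OF K]
  define P where "P = Blinfun (proj K)"
  have P: "blinfun_apply P f = proj K f" for f
    unfolding P_def by (simp add: bounded_linear_Blinfun_apply bounded_linear_proj[OF K'])
  \<comment> \<open>A complex subspace contains the imaginary multiples of \<open>z\<close>, so real
    orthogonality to it is complex orthogonality.\<close>
  have orth: "cinner (f - proj K f) z = 0" if "z \<in> K" for f z
  proof -
    have "inner (scaleC \<i> (f - proj K f)) z = - inner (f - proj K f) (scaleC \<i> z)"
      by (simp only: inner_ell2_def cinner_scaleC_left cinner_scaleC_right) simp
    also have "\<dots> = 0"
      using that by (simp add: proj_orthogonal[OF K'] closed_csubspaceD(3)[OF K])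
    finally show ?thesis
      using that by (simp add: cinner_eq_inner complex_eq_iff proj_orthogonal[OF K'])
  qed
  have proj_eqI: "proj K f = g" if "g \<in> K" "\<And>z. z \<in> K \<Longrightarrow> cinner (f - g) z = 0" for f g
    by (rule proj_unique[OF K']) (use that in \<open>auto simp: inner_ell2_def\<close>)
  have "proj K (scaleC c f) = scaleC c (proj K f)" for c f
    by (rule proj_eqI)
      (use orth in \<open>auto intro: closed_csubspaceD(3)[OF K] proj_in[OF K']
        simp: cinner_scaleC_left simp flip: scaleC_simps(7)\<close>)
  then have "P \<in> bounded_ops" by (simp add: bounded_ops_def P)
  moreover have "P o\<^sub>L R = R o\<^sub>L P" if R: "R \<in> S \<union> adj ` S" for R
  proof (rule blinfun_eqI)
    fix f
    have R': "R \<in> bounded_ops" "\<And>f. f \<in> K \<Longrightarrow> blinfun_apply R f \<in> K"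
      "\<And>f. f \<in> K \<Longrightarrow> blinfun_apply (adj R) f \<in> K"
      using R S inv inv_adj by (auto simp: adj_adj subset_iff intro: adj_bounded_ops)
    \<comment> \<open>Invariance under \<open>R\<close> keeps the image in \<open>K\<close>;
      invariance under \<open>adj R\<close> keeps the image of the remainder orthogonal to
      \<open>K\<close>.\<close>
    have "proj K (blinfun_apply R f) = blinfun_apply R (proj K f)"
    proof (rule proj_eqI)
      fix z assume z: "z \<in> K"
      have "cinner (blinfun_apply R f - blinfun_apply R (proj K f)) z
          = cinner (f - proj K f) (blinfun_apply (adj R) z)"
        by (simp add: cinner_adj_right R' flip: blinfun.diff_right)
      then show "cinner (blinfun_apply R f - blinfun_apply R (proj K f)) z = 0"
        using orth R' z by simp
    qed (simp add: R' proj_in[OF K'])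
    then show "blinfun_apply (P o\<^sub>L R) f = blinfun_apply (R o\<^sub>L P) f" by (simp add: P)
  qed
  ultimately have "P \<in> commutant (S \<union> adj ` S)" by (simp add: commutant_def)
  then have "x o\<^sub>L P = P o\<^sub>L x" using x unfolding vN_generated_def by (rule commutantD[rotated])
  then have "blinfun_apply x (proj K f) = proj K (blinfun_apply x f)"
    by (metis P blinfun_apply_blinfun_compose)
  moreover have "proj K f = f" by (rule proj_eqI) (use f in \<open>auto simp: cinner_eq_inner complex_eq_iff\<close>)
  ultimately show ?thesis using proj_in[OF K'] by metis
qed

section \<open>The trace on the free group factor\<close>

lemma inverse_free_group_inverse [simp]: "inverse (inverse g) = (g :: 'n free_group)"
  by (metis free_group_left_inverse mult.assoc mult_1_left mult_1_right)

lemma inverse_free_group_mult: "inverse (g * h) = inverse h * inverse (g :: 'n free_group)"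
  by (metis free_group_left_inverse free_group_right_inverse mult.assoc mult_1_left mult_1_right)

lemma inverse_free_group_mult_cancel [simp]:
  "inverse g * (g * h) = h" "g * (inverse g * h) = (h :: 'n free_group)"
  "h * g * inverse g = h" "h * inverse g * g = h"
  by (simp_all add: mult.assoc free_group_left_inverse free_group_right_inverse)
    (simp_all add: free_group_left_inverse free_group_right_inverse flip: mult.assoc)

lemma inverse_free_group_1 [simp]: "inverse 1 = (1 :: 'n free_group)"
  by (metis free_group_left_inverse mult_1_right)

lemma left_regular_apply: "ell2_apply (blinfun_apply (left_regular g) f) h = ell2_apply f (inverse g * h)"
  by (simp add: left_regular.rep_eq left_translate.rep_eq)

lemma left_regular_delta: "blinfun_apply (left_regular g) (delta h) = delta (g * h)"
  by (rule ell2_eqI) (auto simp: left_regular_apply ell2_apply_delta)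

lemma left_regular_mult: "left_regular (g * h) = left_regular g o\<^sub>L left_regular h"
  by (rule blinfun_eqI, rule ell2_eqI)
    (simp add: left_regular_apply inverse_free_group_mult mult.assoc)

lemma left_regular_1: "left_regular 1 = id_blinfun"
  by (rule blinfun_eqI, rule ell2_eqI) (simp add: left_regular_apply)

lemma left_regular_bounded_ops: "left_regular g \<in> bounded_ops"
  by (auto simp: bounded_ops_def left_regular_apply ell2_apply_simps intro!: ell2_eqI)

lemma adj_left_regular: "adj (left_regular g) = left_regular (inverse g)"
proof (rule adj_eqI[OF left_regular_bounded_ops])
  fix f f' :: "'a free_group ell2"
  have "(\<Sum>\<^sub>\<infinity>x. cnj (ell2_apply f (g * (inverse g * x))) * ell2_apply f' (inverse g * x))
      = (\<Sum>\<^sub>\<infinity>x. cnj (ell2_apply f (g * x)) * ell2_apply f' x)"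
    by (rule infsum_reindex_bij_betw[OF bij_left_mult_inverse])
  then show "cinner (blinfun_apply (left_regular (inverse g)) f) f'
      = cinner f (blinfun_apply (left_regular g) f')"
    by (simp add: cinner.rep_eq left_regular_apply)
qed

section \<open>Right translations and traciality\<close>

lemma bij_right_mult: "bij (\<lambda>h. h * g :: 'n free_group)"
  by (rule bij_betw_byWitness[where f' = "\<lambda>h. h * inverse g"]) auto

lift_definition right_translate :: "'n free_group \<Rightarrow> 'n free_group ell2 \<Rightarrow> 'n free_group ell2"
  is "\<lambda>g f h. f (h * g)"
proof -
  fix g :: "'n free_group" and f :: "'n free_group \<Rightarrow> complex"
  assume "(\<lambda>x. (cmod (f x))\<^sup>2) summable_on UNIV"
  then show "(\<lambda>x. (cmod (f (x * g)))\<^sup>2) summable_on UNIV"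
    using summable_on_reindex_bij_betw[OF bij_right_mult, of "\<lambda>x. (cmod (f x))\<^sup>2" g] by simp
qed

lift_definition right_regular :: "'n free_group \<Rightarrow> 'n free_group ell2_op" is right_translate
proof (rule bounded_linear_intro)
  fix g :: "'n free_group" and f f' :: "'n free_group ell2" and r :: real
  show "right_translate g (f + f') = right_translate g f + right_translate g f'"
    "right_translate g (r *\<^sub>R f) = r *\<^sub>R right_translate g f"
    by (rule ell2_eqI, simp add: ell2_apply_simps right_translate.rep_eq)+
  show "norm (right_translate g f) \<le> norm f * 1"
    unfolding norm_ell2_eq right_translate.rep_eq
    using infsum_reindex_bij_betw[OF bij_right_mult, of "\<lambda>x. (cmod (ell2_apply f x))\<^sup>2" g]
    by simp
qed

lemma right_regular_apply: "ell2_apply (blinfun_apply (right_regular g) f) h = ell2_apply f (h * g)"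
  by (simp add: right_regular.rep_eq right_translate.rep_eq)

lemma right_regular_commutant: "right_regular g \<in> commutant (range left_regular \<union> adj ` range left_regular)"
  by (auto simp: commutant_def bounded_ops_def right_regular_apply left_regular_apply
      adj_left_regular ell2_apply_simps mult.assoc intro!: ell2_eqI blinfun_eqI)

text \<open>Right translations commute with the factor and carry \<open>delta 1\<close> to every
  \<open>delta g\<close>, so each column of \<open>x\<close> is a translate of its column at the
  identity.\<close>

lemma factor_apply_delta:
  assumes "x \<in> free_group_factor"
  shows "ell2_apply (blinfun_apply x (delta g)) h = ell2_apply (blinfun_apply x (delta 1)) (h * inverse g)"
proof -
  have "delta g = blinfun_apply (right_regular (inverse g)) (delta 1)"
    by (rule ell2_eqI)
      (auto simp: right_regular_apply ell2_apply_delta free_group_right_inverse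
        dest: arg_cong[of _ _ "\<lambda>k. k * g"])
  moreover have "x o\<^sub>L right_regular (inverse g) = right_regular (inverse g) o\<^sub>L x"
    using assms right_regular_commutant unfolding free_group_factor_def vN_generated_def
    by (rule commutantD)
  ultimately show ?thesis by (metis blinfun_apply_blinfun_compose right_regular_apply)
qed

lemma left_regular_in_factor: "left_regular g \<in> free_group_factor"
  unfolding free_group_factor_def
  using vN_generated_superset[of "range left_regular"] left_regular_bounded_ops by blast

lemma factor_bounded_ops: "x \<in> free_group_factor \<Longrightarrow> x \<in> bounded_ops"
  unfolding free_group_factor_def by (rule vN_generated_bounded_ops)

lemma vN_generated_subset_factor: "S \<subseteq> free_group_factor \<Longrightarrow> vN_generated S \<subseteq> free_group_factor"
  unfolding free_group_factor_def
  by (rule vN_generated_mono) (auto intro: left_regular_bounded_ops)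

lemma factor_compose: "x \<in> free_group_factor \<Longrightarrow> y \<in> free_group_factor \<Longrightarrow> x o\<^sub>L y \<in> free_group_factor"
  and factor_id: "id_blinfun \<in> free_group_factor"
  unfolding free_group_factor_def by (auto intro: vN_generated_compose vN_generated_id)

text \<open>Both sides are the value at the identity of a convolution product, and inverting the
  summation variable exchanges the two factors.\<close>

lemma canonical_trace_commute:
  fixes x y :: "'n free_group ell2_op"
  assumes x: "x \<in> free_group_factor" and y: "y \<in> free_group_factor"
  shows "canonical_trace (x o\<^sub>L y) = canonical_trace (y o\<^sub>L x)"
proof -
  have conv: "canonical_trace (x o\<^sub>L y) = (\<Sum>\<^sub>\<infinity>h. ell2_apply (blinfun_apply x (delta 1)) (inverse h)
      * ell2_apply (blinfun_apply y (delta 1)) h)"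
    if x: "x \<in> free_group_factor" for x y :: "'n free_group ell2_op"
  proof -
    have "ell2_apply (blinfun_apply (adj x) (delta 1)) h
        = cnj (ell2_apply (blinfun_apply x (delta 1)) (inverse h))" for h
    proof -
      have "ell2_apply (blinfun_apply (adj x) (delta 1)) h = cinner (blinfun_apply x (delta h)) (delta 1)"
        by (simp add: cinner_adj_right factor_bounded_ops x flip: cinner_delta_left)
      also have "\<dots> = cnj (ell2_apply (blinfun_apply x (delta h)) 1)"
        by (subst cinner_commute) (simp add: cinner_delta_left)
      finally show ?thesis using factor_apply_delta[OF x, of h 1] by simp
    qed
    moreover have "canonical_trace (x o\<^sub>L y) = cinner (blinfun_apply (adj x) (delta 1)) (blinfun_apply y (delta 1))"
      by (simp add: canonical_trace_def cinner_adj factor_bounded_ops x)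
    ultimately show ?thesis by (simp add: cinner.rep_eq)
  qed
  have "bij (inverse :: 'n free_group \<Rightarrow> _)"
    by (rule bij_betw_byWitness[where f' = inverse]) auto
  from infsum_reindex_bij_betw[OF this, of "\<lambda>h. ell2_apply (blinfun_apply x (delta 1)) (inverse h)
      * ell2_apply (blinfun_apply y (delta 1)) h"]
  show ?thesis unfolding conv[OF x] conv[OF y] by (simp add: mult.commute)
qed

lemma canonical_trace_add: "canonical_trace (x + y) = canonical_trace x + canonical_trace y"
  and canonical_trace_scalar: "canonical_trace (scalar_op c o\<^sub>L x) = c * canonical_trace x"
  by (simp_all add: canonical_trace_def blinfun.add_left cinner_add_right scalar_op.rep_eq
      cinner_scaleC_right)

lemma canonical_trace_left_regular: "canonical_trace (left_regular g) = (if g = 1 then 1 else 0)"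
  by (simp add: canonical_trace_def left_regular_delta cinner_delta_left ell2_apply_delta)

lemma canonical_trace_id: "canonical_trace id_blinfun = 1"
  using canonical_trace_left_regular[of 1] by (simp add: left_regular_1)

section \<open>Alternating products\<close>

definition centered :: "'n free_group ell2_op set \<Rightarrow> 'n free_group ell2_op set" where
  "centered A = {a \<in> A. canonical_trace a = 0}"

definition word_op :: "('i \<times> 'a ell2_op) list \<Rightarrow> 'a ell2_op" where
  "word_op xs = foldr (o\<^sub>L) (map snd xs) id_blinfun"

text \<open>Centering is left to the family \<open>A\<close>, so that one predicate serves for words
  of centered elements and for words in spanning sets.\<close>

definition alternating :: "('i \<Rightarrow> 'b set) \<Rightarrow> ('i \<times> 'b) list \<Rightarrow> bool" where
  "alternating A xs \<longleftrightarrow> distinct_adj (map fst xs) \<and> (\<forall>(i, a)\<in>set xs. a \<in> A i)"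

lemma word_op_simps [simp]:
  "word_op [] = id_blinfun" "word_op ((i, a) # xs) = a o\<^sub>L word_op xs"
  by (simp_all add: word_op_def)

lemma word_op_append: "word_op (xs @ ys) = word_op xs o\<^sub>L word_op ys"
  by (induction xs) (auto simp: blinfun_compose_assoc)

lemma alternating_Nil [simp]: "alternating A []"
  by (simp add: alternating_def)

lemma alternating_Cons:
  "alternating A ((i, a) # xs) \<longleftrightarrow> a \<in> A i \<and> (xs = [] \<or> fst (hd xs) \<noteq> i) \<and> alternating A xs"
  by (cases xs) (auto simp: alternating_def)

lemma word_op_in_factor:
  "(\<forall>(i, a)\<in>set xs. a \<in> free_group_factor) \<Longrightarrow> word_op xs \<in> free_group_factor"
  by (induction xs) (auto intro: factor_compose factor_id)

lemma freely_independentI: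
  fixes A :: "'i \<Rightarrow> 'n free_group ell2_op set"
  assumes "\<And>i. A i \<subseteq> M"
    and "\<And>xs. alternating (\<lambda>i. centered (A i)) xs \<Longrightarrow> xs \<noteq> [] \<Longrightarrow> canonical_trace (word_op xs) = 0"
  shows "freely_independent M canonical_trace UNIV A"
  unfolding freely_independent_def
proof (intro conjI allI impI ballI assms(1))
  fix "is" :: "'i list" and as :: "'n free_group ell2_op list"
  assume *: "is \<noteq> [] \<and> length as = length is \<and> distinct_adj is \<and>
    (\<forall>k<length is. is ! k \<in> UNIV \<and> as ! k \<in> A (is ! k) \<and> canonical_trace (as ! k) = 0)"
  then have "alternating (\<lambda>i. centered (A i)) (zip is as)"
    by (auto simp: alternating_def centered_def set_zip)
  moreover have "zip is as \<noteq> []" using * by (cases "is"; cases as) auto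
  ultimately have "canonical_trace (word_op (zip is as)) = 0" by (rule assms(2))
  then show "canonical_trace (foldr (o\<^sub>L) as id_blinfun) = 0" using * by (simp add: word_op_def)
qed

text \<open>By traciality, \<open>tr (p a q) = \<langle>(q p)\<^sup>* \<delta>\<^sub>1, a \<delta>\<^sub>1\<rangle>\<close> is continuous in \<open>a \<delta>\<^sub>1\<close>, so the letters of a word
  can be replaced one at a time by elements that are total in the 2-norm.\<close>

lemma alternating_trace_zero:
  fixes A G :: "'i \<Rightarrow> 'n free_group ell2_op set"
  assumes A: "\<And>i. A i \<subseteq> free_group_factor" and G: "\<And>i. G i \<subseteq> free_group_factor"
    and dense: "\<And>i a. a \<in> A i \<Longrightarrow>
      blinfun_apply a (delta 1) \<in> closed_cspan (insert (delta 1) ((\<lambda>g. blinfun_apply g (delta 1)) ` G i))"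
    and G0: "\<And>xs. alternating G xs \<Longrightarrow> xs \<noteq> [] \<Longrightarrow> canonical_trace (word_op xs) = 0"
    and xs: "alternating (\<lambda>i. centered (A i)) xs" "xs \<noteq> []"
  shows "canonical_trace (word_op xs) = 0"
proof -
  \<comment> \<open>Generalised for the induction: a prefix still made of arbitrary centered
    letters, a suffix already in the sets \<open>G\<close>. At each step the last letter of the
    prefix crosses over.\<close>
  have "canonical_trace (word_op (ys @ zs)) = 0"
    if "distinct_adj (map fst (ys @ zs))" "\<forall>(i, a)\<in>set ys. a \<in> centered (A i)"
      "\<forall>(i, a)\<in>set zs. a \<in> G i" "ys @ zs \<noteq> []" for ys zs
    using that
  proof (induction ys arbitrary: zs rule: rev_induct)
    case Nil
    then show ?case by (intro G0) (auto simp: alternating_def)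
  next
    case (snoc y ys)
    obtain i a where y: "y = (i, a)" by (cases y)
    have a: "a \<in> A i" "canonical_trace a = 0" using snoc.prems y by (auto simp: centered_def)
    define p q where "p = word_op ys" and "q = word_op zs"
    have p: "p \<in> free_group_factor" unfolding p_def
      by (rule word_op_in_factor) (use snoc.prems A in \<open>fastforce simp: centered_def\<close>)
    have q: "q \<in> free_group_factor" unfolding q_def
      by (rule word_op_in_factor) (use snoc.prems G in fastforce)
    define z where "z = blinfun_apply (adj (q o\<^sub>L p)) (delta 1)"
    have tr: "canonical_trace (p o\<^sub>L (b o\<^sub>L q)) = cinner z (blinfun_apply b (delta 1))"
      if b: "b \<in> free_group_factor" for b
    proof -
      have "canonical_trace (p o\<^sub>L (b o\<^sub>L q)) = canonical_trace (q o\<^sub>L (p o\<^sub>L b))"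
        using canonical_trace_commute[OF factor_compose[OF p b] q] by (simp add: blinfun_compose_assoc)
      also have "\<dots> = cinner z (blinfun_apply b (delta 1))"
        unfolding z_def canonical_trace_def
        by (simp add: cinner_adj[OF factor_bounded_ops] factor_compose p q)
      finally show ?thesis .
    qed
    \<comment> \<open>For \<open>f\<close> of the form \<open>b\<close> applied to
      \<open>delta 1\<close> the condition reads tr(p b q) = tr(b) tr(p q). The right side accounts
      for a nonzero tr(p q), so that \<open>delta 1\<close> lies in \<open>K\<close> as
      well.\<close>
    define K where "K = {f. cinner z f = cinner (delta 1) f * cinner z (delta 1)}"
    have "blinfun_apply g (delta 1) \<in> K" if g: "g \<in> G i" for g
    proof -
      have "canonical_trace (word_op (ys @ (i, g) # zs)) = 0"
        by (rule snoc.IH) (use snoc.prems g y in auto)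
      then have "cinner z (blinfun_apply g (delta 1)) = 0"
        using g G tr[of g] by (auto simp: word_op_append p_def q_def)
      \<comment> \<open>Words of length one show that \<open>g\<close> itself is centered.\<close>
      moreover have "canonical_trace (word_op [(i, g)]) = 0"
        by (rule G0) (use g in \<open>auto simp: alternating_Cons\<close>)
      ultimately show ?thesis by (simp add: K_def canonical_trace_def)
    qed
    moreover have "delta 1 \<in> K" by (simp add: K_def cinner_delta_left ell2_apply_delta)
    ultimately have "closed_cspan (insert (delta 1) ((\<lambda>g. blinfun_apply g (delta 1)) ` G i)) \<subseteq> K"
      unfolding K_def by (intro closed_cspan_least closed_csubspace_functional_kernel) auto
    then have "blinfun_apply a (delta 1) \<in> K" using dense[OF a(1)] by blast
    then have "cinner z (blinfun_apply a (delta 1)) = 0"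
      using a(2) by (simp add: K_def canonical_trace_def)
    then show ?case using tr[of a] a A y by (auto simp: word_op_append p_def q_def blinfun_compose_assoc)
  qed
  from this[of xs "[]"] show ?thesis using xs by (auto simp: alternating_def)
qed

section \<open>Freeness of the generators\<close>

lemma Rep_generator: "Rep_free_group (generator i) = [(i, True)]"
  and Rep_inverse_generator: "Rep_free_group (inverse (generator i)) = [(i, False)]"
  by (simp_all add: generator.rep_eq inverse_free_group.rep_eq inv_letter_def)

lemma foldr_push_replicate:
  "w = [] \<or> fst (hd w) \<noteq> i \<Longrightarrow> foldr push (replicate k (i, s)) w = replicate k (i, s) @ w"
  by (induction k) (auto simp: push_def inv_letter_def hd_append split: if_splits)

lemma Rep_power:
  assumes "Rep_free_group g = [(i, s)]"
  shows "Rep_free_group (g ^ k) = replicate k (i, s)"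
proof (induction k)
  case (Suc k)
  then show ?case
    by (cases k) (auto simp: times_free_group.rep_eq assms push_def inv_letter_def)
qed (simp add: one_free_group.rep_eq)

text \<open>Exponents are natural numbers, so the two signs are listed separately;
  \<open>Suc\<close> leaves out the identity, whose trace is 1.\<close>

definition generator_powers :: "'n \<Rightarrow> 'n free_group set" where
  "generator_powers i = range (\<lambda>k. generator i ^ Suc k) \<union> range (\<lambda>k. inverse (generator i) ^ Suc k)"

text \<open>Adjacent blocks belong to different generators, so their reduced words concatenate
  without cancellation. The generator of the first letter is recorded because the next block on the
  left is compared with it.\<close>

lemma alternating_generator_powers:
  assumes "alternating (\<lambda>i. left_regular ` generator_powers i) xs" "xs \<noteq> []"
  shows "\<exists>g. word_op xs = left_regular g \<and> Rep_free_group g \<noteq> [] \<and>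
    fst (hd (Rep_free_group g)) = fst (hd xs)"
  using assms
proof (induction xs)
  case (Cons x xs)
  obtain i a where x: "x = (i, a)" by (cases x)
  with Cons.prems obtain h where h: "a = left_regular h" "h \<in> generator_powers i"
    by (auto simp: alternating_Cons)
  then obtain k s where hs: "Rep_free_group h = replicate (Suc k) (i, s)"
  proof -
    from h(2) have "\<exists>k s. Rep_free_group h = replicate (Suc k) (i, s)"
      unfolding generator_powers_def
      by (auto simp: Rep_power[OF Rep_generator] Rep_power[OF Rep_inverse_generator]
          simp del: power_Suc replicate_Suc)
    then show ?thesis using that by blast
  qed
  obtain g where g: "word_op xs = left_regular g"
    "Rep_free_group g = [] \<or> fst (hd (Rep_free_group g)) \<noteq> i"
  proof (cases "xs = []")
    case True
    then show ?thesis using that[of 1] by (simp add: left_regular_1 one_free_group.rep_eq)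
  next
    case False
    then show ?thesis using Cons that x by (auto simp: alternating_Cons)
  qed
  have "Rep_free_group (h * g) = replicate (Suc k) (i, s) @ Rep_free_group g"
    using foldr_push_replicate[OF g(2), of "Suc k" s] by (simp add: times_free_group.rep_eq hs)
  then show ?case using x h g by (intro exI[of _ "h * g"]) (simp add: left_regular_mult)
qed simp

lemma gen_algebra_subset_factor: "gen_algebra i \<subseteq> free_group_factor"
  unfolding gen_algebra_def gen_unitary_def
  by (rule vN_generated_subset_factor) (simp add: left_regular_in_factor)

text \<open>The vectors that a bounded operator sends into a closed span form a closed subspace, so
  invariance is tested on the vectors of \<open>X\<close>, and there up to the closed span.\<close>

lemma vN_generated_dense:
  assumes S: "S \<subseteq> bounded_ops" and v: "v \<in> X"
    and inv: "\<And>a f. a \<in> S \<union> adj ` S \<Longrightarrow> f \<in> X \<Longrightarrow> blinfun_apply a f \<in> closed_cspan X"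
    and x: "x \<in> vN_generated S"
  shows "blinfun_apply x v \<in> closed_cspan X"
proof (rule vN_generated_invariant[OF S closed_csubspace_closed_cspan _ _ x])
  have *: "blinfun_apply a f \<in> closed_cspan X" if "a \<in> S \<union> adj ` S" "f \<in> closed_cspan X" for a f
  proof -
    have "a \<in> bounded_ops" using that S adj_bounded_ops by blast
    then have "closed_cspan X \<subseteq> {f. blinfun_apply a f \<in> closed_cspan X}"
      by (intro closed_cspan_least closed_csubspace_vimage closed_csubspace_closed_cspan)
        (use inv that in auto)
    then show ?thesis using that by blast
  qed
  show "blinfun_apply a f \<in> closed_cspan X" "blinfun_apply (adj a) f \<in> closed_cspan X"
    if "a \<in> S" "f \<in> closed_cspan X" for a f
    using * that by auto
  show "v \<in> closed_cspan X" using v closed_cspan_superset by blast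
qed

text \<open>The powers of u_i, applied to \<open>delta 1\<close>, form an orbit invariant under u_i
  and its adjoint. This reduces freeness to nontrivial reduced words, whose trace is 0.\<close>

lemma gen_algebras_free:
  assumes "alternating (\<lambda>i. centered (gen_algebra i)) xs" "xs \<noteq> []"
  shows "canonical_trace (word_op xs) = 0"
proof (rule alternating_trace_zero[OF gen_algebra_subset_factor _ _ _ assms,
      where G = "\<lambda>i. left_regular ` generator_powers i"])
  fix i :: 'a
  show "left_regular ` generator_powers i \<subseteq> free_group_factor"
    using left_regular_in_factor by blast
  define D where "D = range (\<lambda>k. delta (generator i ^ k)) \<union> range (\<lambda>k. delta (inverse (generator i) ^ k))"
  have D: "insert (delta 1) ((\<lambda>g. blinfun_apply g (delta 1)) ` (left_regular ` generator_powers i)) = D"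
  proof -
    have "range f = insert (f 0) (range (\<lambda>k. f (Suc k)))" for f :: "nat \<Rightarrow> 'a free_group ell2"
      by (subst UNIV_nat_eq) (simp add: image_image)
    from this[of "\<lambda>k. delta (generator i ^ k)"] this[of "\<lambda>k. delta (inverse (generator i) ^ k)"]
    show ?thesis unfolding D_def generator_powers_def
      by (auto simp: image_Un image_image left_regular_delta)
  qed
  define P where "P g = range ((^) g) \<union> range ((^) (inverse g))" for g :: "'a free_group"
  have P: "g * h \<in> P g" if "h \<in> P g" for g h
    using that unfolding P_def
  proof (elim UnE rangeE)
    fix k assume "h = g ^ k"
    then show "g * h \<in> range ((^) g) \<union> range ((^) (inverse g))"
      by (auto intro: range_eqI[of _ _ "Suc k"])
  next
    \<comment> \<open>For \<open>k = 0\<close> the product leaves the negative powers and is the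
      first positive one; otherwise one factor cancels.\<close>
    fix k assume "h = inverse g ^ k"
    then show "g * h \<in> range ((^) g) \<union> range ((^) (inverse g))"
      by (cases k) (auto intro: range_eqI[of _ _ 1])
  qed
  have D': "D = delta ` P (generator i)" by (auto simp: D_def P_def)
  have "P (inverse (generator i)) = P (generator i)" by (auto simp: P_def)
  then have step: "blinfun_apply a f \<in> D"
    if "a \<in> {gen_unitary i} \<union> adj ` {gen_unitary i}" "f \<in> D" for a f
    using that P[of _ "generator i"] P[of _ "inverse (generator i)"] unfolding D'
    by (auto simp: gen_unitary_def adj_left_regular left_regular_delta)
  fix a :: "'a free_group ell2_op" assume a: "a \<in> gen_algebra i"
  show "blinfun_apply a (delta 1) \<in> closed_cspan
      (insert (delta 1) ((\<lambda>g. blinfun_apply g (delta 1)) ` (left_regular ` generator_powers i)))"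
    unfolding D
  proof (rule vN_generated_dense[where S = "{gen_unitary i}"])
    show "{gen_unitary i} \<subseteq> bounded_ops" by (simp add: gen_unitary_def left_regular_bounded_ops)
    show "a \<in> vN_generated {gen_unitary i}" using a by (simp add: gen_algebra_def)
    show "delta 1 \<in> D" by (auto simp: D_def intro: range_eqI[of _ _ 0])
    show "blinfun_apply b f \<in> closed_cspan D"
      if "b \<in> {gen_unitary i} \<union> adj ` {gen_unitary i}" "f \<in> D" for b f
      using step[OF that] closed_cspan_superset by blast
  qed
next
  fix xs :: "('a \<times> 'a free_group ell2_op) list"
  assume "alternating (\<lambda>i. left_regular ` generator_powers i) xs" "xs \<noteq> []"
  from alternating_generator_powers[OF this] show "canonical_trace (word_op xs) = 0"
    by (auto simp: canonical_trace_left_regular one_free_group.rep_eq)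
qed

section \<open>The sign function on the interval\<close>

lemma interval_measure_eq: "interval_measure = density (lebesgue_on {-1..1}) (\<lambda>_. ennreal (1 / 2))"
proof -
  have "emeasure (lebesgue_on {-1..1::real}) {-1..1} = 2"
    by (subst emeasure_restrict_space) auto
  moreover have "(1::ennreal) / 2 = ennreal (1 / 2)"
    by (metis divide_ennreal ennreal_1 ennreal_numeral zero_le_one zero_less_numeral)
  moreover have "(\<lambda>x. indicator {-1..1} x / 2 :: ennreal) \<in> borel_measurable (lebesgue_on {-1..1::real})
      \<longleftrightarrow> (\<lambda>_. 1 / 2 :: ennreal) \<in> borel_measurable (lebesgue_on {-1..1::real})"
    by (rule measurable_cong) simp
  ultimately show ?thesis
    unfolding interval_measure_def uniform_measure_def
    by (intro density_cong AE_I2) auto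
qed

lemma borel_measurable_interval_measure: "borel_measurable interval_measure = borel_measurable (lebesgue_on {-1..1})"
  by (rule measurable_cong_sets) (simp_all add: interval_measure_eq)

lemma AE_interval_measure: "(AE x in interval_measure. P x) \<longleftrightarrow> (AE x in lebesgue_on {-1..1}. P x)"
  unfolding interval_measure_eq by (subst AE_density) auto

lemma integral_interval_measure:
  fixes h :: "real \<Rightarrow> complex"
  assumes "h \<in> borel_measurable (lebesgue_on {-1..1})"
  shows "(LINT x|interval_measure. h x) = (1 / 2) *\<^sub>R integral\<^sup>L (lebesgue_on {-1..1}) h"
  unfolding interval_measure_eq using assms by (subst integral_density) auto

lemma integral_interval_measure_odd:
  fixes h :: "real \<Rightarrow> complex"
  assumes h: "h \<in> borel_measurable interval_measure" and odd: "AE x in interval_measure. h (- x) = - h x"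
  shows "(LINT x|interval_measure. h x) = 0"
proof (cases "integrable (lebesgue_on {-1..1}) h")
  case True
  then have "integrable (lebesgue_on {-1..1}) (\<lambda>x. h (- x))"
    using integrable_reflect_real[of 1 "-1" h] by simp
  then have "integral\<^sup>L (lebesgue_on {-1..1}) (\<lambda>x. h (- x)) = integral\<^sup>L (lebesgue_on {-1..1}) (\<lambda>x. - h x)"
    using odd True by (intro integral_cong_AE) (auto simp: AE_interval_measure)
  moreover have "integral\<^sup>L (lebesgue_on {-1..1}) (\<lambda>x. h (- x)) = integral\<^sup>L (lebesgue_on {-1..1}) h"
    using integral_reflect_real[of 1 "-1" h] by simp
  ultimately have "integral\<^sup>L (lebesgue_on {-1..1}) h = 0"
    by simp
  then show ?thesis
    using h by (simp add: borel_measurable_interval_measure integral_interval_measure)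
next
  \<comment> \<open>The integral of a non-integrable function has the default value 0.\<close>
  case False
  then have "integral\<^sup>L (lebesgue_on {-1..1}) h = 0" by (rule not_integrable_integral_eq)
  then show ?thesis
    using h by (simp add: borel_measurable_interval_measure integral_interval_measure)
qed

lemma Linf_mult: "f \<in> Linf \<Longrightarrow> g \<in> Linf \<Longrightarrow> (\<lambda>x. f x * g x) \<in> Linf"
  unfolding Linf_def
proof safe
  fix C D
  assume "AE x in interval_measure. cmod (f x) \<le> C" "AE x in interval_measure. cmod (g x) \<le> D"
  then have "AE x in interval_measure. cmod (f x * g x) \<le> C * D"
  proof eventually_elim
    case (elim x)
    then have "0 \<le> C" using norm_ge_zero order_trans by blast
    then show ?case using elim unfolding norm_mult by (intro mult_mono) auto
  qed
  then show "\<exists>C. AE x in interval_measure. cmod (f x * g x) \<le> C" by blast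
qed measurable

lemma borel_in_Linf:
  assumes "f \<in> borel_measurable borel" "\<And>x. cmod (f x) \<le> C"
  shows "f \<in> Linf"
proof -
  have "f \<in> borel_measurable lebesgue" using assms(1) by (simp add: measurable_completion)
  then show ?thesis
    unfolding Linf_def borel_measurable_interval_measure
    using assms(2) by (auto intro: measurable_restrict_space1)
qed

text \<open>The value at \<open>0\<close> is \<open>0 / 0 = 0\<close>.\<close>

definition sign_function :: "real \<Rightarrow> complex" where
  "sign_function x = complex_of_real (\<bar>x\<bar> / x)"

lemma sign_function_Linf: "sign_function \<in> Linf"
proof (rule borel_in_Linf)
  show "sign_function \<in> borel_measurable borel" unfolding sign_function_def by measurable
  show "cmod (sign_function x) \<le> 1" for x
    by (cases "x = 0") (auto simp: sign_function_def norm_divide)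
qed

text \<open>The square is 0 at the origin, hence the exceptional null set. The identification sees
  only classes, so this still yields that w_i squares to the identity.\<close>

lemma sign_function_squared: "AE x in interval_measure. sign_function x * sign_function x = 1"
proof -
  have "AE x in lebesgue. x \<noteq> (0::real)"
    by (rule AE_completion) (simp add: AE_lborel_singleton)
  then have "AE x in lebesgue_on {-1..1}. x \<noteq> (0::real)"
    by (subst AE_restrict_space_iff) (auto elim: eventually_mono)
  then show ?thesis unfolding AE_interval_measure
    by eventually_elim (simp add: sign_function_def abs_if)
qed

text \<open>Odd times even is odd: the source of tr(w_i b) = 0 for b in B_i.\<close>

lemma integral_sign_function_even:
  assumes "f \<in> Linf_even"
  shows "(LINT x|interval_measure. sign_function x * f x) = 0"
proof (rule integral_interval_measure_odd)
  show "(\<lambda>x. sign_function x * f x) \<in> borel_measurable interval_measure"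
    using Linf_mult[OF sign_function_Linf, of f] assms by (auto simp: Linf_def Linf_even_def)
  have "AE x in interval_measure. f (- x) = f x" using assms by (simp add: Linf_even_def)
  then show "AE x in interval_measure. sign_function (- x) * f (- x) = - (sign_function x * f x)"
    by eventually_elim (simp add: sign_function_def)
qed

section \<open>The radial algebra\<close>

lemma gen_unitary_bounded_ops: "gen_unitary i \<in> bounded_ops"
  by (simp add: gen_unitary_def left_regular_bounded_ops)

lemma gen_real_unitary_bounded_ops: "gen_unitary i + adj (gen_unitary i) \<in> bounded_ops"
  by (intro bounded_ops_add adj_bounded_ops gen_unitary_bounded_ops)

lemma gen_real_algebra_subset: "gen_real_algebra i \<subseteq> gen_algebra i"
proof -
  have S: "{gen_unitary i} \<subseteq> bounded_ops" by (simp add: gen_unitary_bounded_ops)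
  then have "gen_unitary i \<in> gen_algebra i" using vN_generated_superset unfolding gen_algebra_def by blast
  then show ?thesis unfolding gen_real_algebra_def gen_algebra_def
    by (intro vN_generated_mono[OF S]) (simp add: vN_generated_add vN_generated_adj[OF S])
qed

lemma gen_real_unitary_centered: "gen_unitary i + adj (gen_unitary i) \<in> centered (gen_real_algebra i)"
proof -
  have "generator i \<noteq> 1" "inverse (generator i) \<noteq> 1"
    using Rep_generator[of i] Rep_inverse_generator[of i] one_free_group.rep_eq by (metis list.distinct(1))+
  then have "canonical_trace (gen_unitary i + adj (gen_unitary i)) = 0"
    by (simp add: canonical_trace_add gen_unitary_def adj_left_regular canonical_trace_left_regular)
  then show ?thesis
    using vN_generated_superset[of "{gen_unitary i + adj (gen_unitary i)}"] gen_real_unitary_bounded_ops[of i]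
    by (simp add: centered_def gen_real_algebra_def)
qed

lemma sum_gen_real_unitary:
  assumes "finite F"
  shows "(\<Sum>i\<in>F. gen_unitary i + adj (gen_unitary i)) \<in> free_group_factor"
    and "adj (\<Sum>i\<in>F. gen_unitary i + adj (gen_unitary i)) = (\<Sum>i\<in>F. gen_unitary i + adj (gen_unitary i))"
  using assms
proof (induction F)
  case empty
  \<comment> \<open>The empty sum is the zero operator, which enters the factor as the scalar
    0.\<close>
  have "scalar_op 0 = (0 :: 'a free_group ell2_op)" by (rule blinfun_eqI) (simp add: scalar_op.rep_eq)
  then show "(\<Sum>i\<in>{}. gen_unitary i + adj (gen_unitary i)) \<in> (free_group_factor :: 'a free_group ell2_op set)"
    unfolding free_group_factor_def
    using vN_generated_scalar[of 0 "range (left_regular :: 'a free_group \<Rightarrow> _)"] by simp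
  show "adj (\<Sum>i\<in>{}. gen_unitary i + adj (gen_unitary i)) = (\<Sum>i\<in>({}::'a set). gen_unitary i + adj (gen_unitary i))"
    using \<open>scalar_op 0 = 0\<close> by (intro adj_eqI) (simp_all add: bounded_ops_def cinner_eq_inner Complex_eq)
next
  case (insert i F)
  let ?b = "gen_unitary i + adj (gen_unitary i)"
  have b: "?b \<in> free_group_factor"
    using gen_real_unitary_centered[of i] gen_real_algebra_subset[of i] gen_algebra_subset_factor[of i]
    by (auto simp: centered_def)
  show "(\<Sum>i\<in>insert i F. gen_unitary i + adj (gen_unitary i)) \<in> free_group_factor"
    using vN_generated_add[OF b[unfolded free_group_factor_def] insert.IH(1)[unfolded free_group_factor_def]]
      insert.hyps by (simp add: free_group_factor_def)
  have "adj ?b = ?b"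
    using gen_unitary_bounded_ops[of i] by (simp add: adj_add adj_adj adj_bounded_ops add.commute)
  then show "adj (\<Sum>i\<in>insert i F. gen_unitary i + adj (gen_unitary i))
      = (\<Sum>i\<in>insert i F. gen_unitary i + adj (gen_unitary i))"
    using insert adj_add[OF gen_real_unitary_bounded_ops[of i] factor_bounded_ops[OF insert.IH(1)]] by simp
qed

text \<open>Spanning words for the algebra generated by all the B_k; the empty word is among them
  and stands for the identity.\<close>

abbreviation "real_words \<equiv> {bs. alternating (\<lambda>i. centered (gen_real_algebra i)) bs}"

lemma real_word_in_factor: "bs \<in> real_words \<Longrightarrow> word_op bs \<in> free_group_factor"
proof (rule word_op_in_factor)
  have *: "centered (gen_real_algebra i) \<subseteq> free_group_factor" for i :: 'a
    using gen_real_algebra_subset[of i] gen_algebra_subset_factor[of i] by (auto simp: centered_def)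
  have "a \<in> free_group_factor" if "bs \<in> real_words" "(i, a) \<in> set bs" for i a
  proof -
    have "a \<in> centered (gen_real_algebra i)" using that by (auto simp: alternating_def)
    then show ?thesis by (rule subsetD[OF *])
  qed
  then show "bs \<in> real_words \<Longrightarrow> \<forall>(i, a)\<in>set bs. a \<in> free_group_factor" by auto
qed

lemma canonical_trace_scalar_op: "canonical_trace (scalar_op c) = c"
  using canonical_trace_scalar[of c id_blinfun] by (simp add: canonical_trace_id)

text \<open>When \<open>b\<close> meets a first letter of its own index, the product of the two is
  split into its trace and a centered rest, which gives a word of the same length plus a multiple of
  a shorter one. Otherwise \<open>b\<close> is simply prepended.\<close>

lemma letter_real_word:
  assumes b: "b \<in> centered (gen_real_algebra i)" and bs: "bs \<in> real_words"
  shows "blinfun_apply b (blinfun_apply (word_op bs) f)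
    \<in> closed_cspan ((\<lambda>bs. blinfun_apply (word_op bs) f) ` real_words)" (is "_ \<in> closed_cspan ?X")
proof -
  have X: "blinfun_apply (word_op cs) f \<in> closed_cspan ?X" if "cs \<in> real_words" for cs
    by (rule subsetD[OF closed_cspan_superset imageI[OF that]])
  show ?thesis
  proof (cases "bs = [] \<or> fst (hd bs) \<noteq> i")
    case True
    then show ?thesis using X[of "(i, b) # bs"] b bs by (simp add: alternating_Cons)
  next
    case False
    then obtain c cs where bs': "bs = (i, c) # cs" by (cases bs) auto
    then have c: "c \<in> centered (gen_real_algebra i)" and cs: "cs \<in> real_words" "cs = [] \<or> fst (hd cs) \<noteq> i"
      using bs by (auto simp: alternating_Cons)
    define t where "t = canonical_trace (b o\<^sub>L c)"
    define d where "d = (b o\<^sub>L c) + scalar_op (- t)"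
    have "d \<in> centered (gen_real_algebra i)"
      using b c unfolding centered_def gen_real_algebra_def d_def
      by (simp add: canonical_trace_add canonical_trace_scalar_op t_def vN_generated_add vN_generated_compose vN_generated_scalar)
    then have "blinfun_apply (word_op ((i, d) # cs)) f \<in> closed_cspan ?X"
      using cs by (intro X) (simp add: alternating_Cons)
    moreover have "scaleC t (blinfun_apply (word_op cs) f) \<in> closed_cspan ?X"
      by (intro closed_csubspaceD(3)[OF closed_csubspace_closed_cspan] X cs)
    ultimately have "blinfun_apply (word_op ((i, d) # cs)) f + scaleC t (blinfun_apply (word_op cs) f)
        \<in> closed_cspan ?X"
      by (rule closed_csubspaceD(2)[OF closed_csubspace_closed_cspan])
    then show ?thesis by (simp add: bs' d_def blinfun.add_left scalar_op.rep_eq)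
  qed
qed

text \<open>The generator is self-adjoint and a sum of letters centered in the B_i, so it preserves
  the closed span of the real words, even though these may lie outside the radial MASA.\<close>

lemma radial_masa_dense:
  fixes x :: "'n::finite free_group ell2_op"
  assumes "x \<in> radial_masa"
  shows "blinfun_apply x f \<in> closed_cspan ((\<lambda>bs. blinfun_apply (word_op bs) f) ` real_words)" (is "_ \<in> closed_cspan ?X")
proof (rule vN_generated_dense)
  let ?r = "\<Sum>i\<in>(UNIV::'n set). gen_unitary i + adj (gen_unitary i)"
  show "x \<in> vN_generated {?r}" using assms by (simp add: radial_masa_def)
  show "{?r} \<subseteq> bounded_ops" using sum_gen_real_unitary(1)[of "UNIV::'n set"] by (simp add: factor_bounded_ops)
  show "f \<in> ?X" by (rule image_eqI[of _ _ "[]"]) auto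
  fix a g assume a: "a \<in> {?r} \<union> adj ` {?r}" and "g \<in> ?X"
  then obtain bs where bs: "bs \<in> real_words" "g = blinfun_apply (word_op bs) f" by blast
  have "(\<Sum>i\<in>F. blinfun_apply (gen_unitary i + adj (gen_unitary i)) g) \<in> closed_cspan ?X" if "finite F" for F
    using that
    by (induction F)
      (auto intro: closed_csubspaceD[OF closed_csubspace_closed_cspan]
        simp: bs letter_real_word[OF gen_real_unitary_centered bs(1)])
  moreover have "a = ?r" using a sum_gen_real_unitary(2)[of "UNIV::'n set"] by auto
  ultimately show "blinfun_apply a g \<in> closed_cspan ?X" by (simp add: blinfun.sum_left)
qed

lemma radial_masa_subset_factor: "radial_masa \<subseteq> free_group_factor"
  unfolding radial_masa_def by (rule vN_generated_subset_factor) (simp add: sum_gen_real_unitary)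

section \<open>Regrouping\<close>

definition pair_power :: "('n \<Rightarrow> 'a ell2_op) \<Rightarrow> 'n \<Rightarrow> 'n \<Rightarrow> nat \<Rightarrow> 'a ell2_op" where
  "pair_power w i j k = (((o\<^sub>L) (w i o\<^sub>L w j)) ^^ k) id_blinfun"

lemma pair_power_simps [simp]:
  "pair_power w i j 0 = id_blinfun"
  "pair_power w i j (Suc k) = w i o\<^sub>L (w j o\<^sub>L pair_power w i j k)"
  by (simp_all add: pair_power_def blinfun_compose_assoc)

section \<open>Freeness of \<open>w i o\<^sub>L w j\<close> from five algebraic properties of the
  \<open>w i\<close>\<close>

context
  fixes w :: "'n::finite \<Rightarrow> 'n free_group ell2_op"
  assumes w_in: "\<And>i. w i \<in> gen_algebra i"
    and w_adj: "\<And>i. adj (w i) = w i"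
    and w_sq: "\<And>i. w i o\<^sub>L w i = id_blinfun"
    and w_commute: "\<And>i b. b \<in> gen_real_algebra i \<Longrightarrow> b o\<^sub>L w i = w i o\<^sub>L b"
    and w_trace: "\<And>i b. b \<in> gen_real_algebra i \<Longrightarrow> canonical_trace (w i o\<^sub>L b) = 0"
begin

lemma w_w [simp]: "w i o\<^sub>L (w i o\<^sub>L a) = a"
  by (simp add: w_sq flip: blinfun_compose_assoc)

lemma w_in_factor: "w i \<in> free_group_factor"
  by (rule subsetD[OF gen_algebra_subset_factor w_in])

lemma w_centered: "w i \<in> centered (gen_algebra i)"
  using w_trace[of id_blinfun i] w_in by (simp add: centered_def gen_real_algebra_def vN_generated_id)

lemma pair_power_in_factor: "pair_power w i j k \<in> free_group_factor"
  by (induction k) (simp_all add: factor_id factor_compose w_in_factor)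

text \<open>The possible first letters of a regrouped real word: a letter of B_i, alone or with the
  \<open>w i\<close> of the following power absorbed on its right. \<open>w i\<close> itself is kept
  out, since another \<open>w i\<close> on its left would give the identity, which is not
  centered.\<close>

definition open_letters :: "'n \<Rightarrow> 'n free_group ell2_op set" where
  "open_letters i = centered (gen_real_algebra i) \<union> (\<lambda>b. b o\<^sub>L w i) ` centered (gen_real_algebra i)"

lemma open_letters_centered: "open_letters i \<subseteq> centered (gen_algebra i)"
proof -
  have "b o\<^sub>L w i \<in> centered (gen_algebra i)" if "b \<in> gen_real_algebra i" for b
    using that w_in[of i] w_trace[OF that] gen_real_algebra_subset[of i] w_commute[OF that]
    unfolding centered_def gen_algebra_def by (auto intro: vN_generated_compose)
  then show ?thesis using gen_real_algebra_subset[of i] unfolding open_letters_def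
    by (auto simp: centered_def)
qed

text \<open>With b in B_i the two cases are w b = b w, again an open letter, and w b w = b.\<close>

lemma w_open_letter:
  assumes "c \<in> open_letters i"
  shows "w i o\<^sub>L c \<in> centered (gen_algebra i)"
proof -
  from assms consider "c \<in> centered (gen_real_algebra i)"
    | b where "b \<in> centered (gen_real_algebra i)" "c = b o\<^sub>L w i"
    unfolding open_letters_def by blast
  then show ?thesis
  proof cases
    case 1
    then have "w i o\<^sub>L c = c o\<^sub>L w i" using w_commute[of c i] by (simp add: centered_def)
    moreover have "c o\<^sub>L w i \<in> open_letters i" using 1 by (simp add: open_letters_def)
    ultimately show ?thesis using open_letters_centered by auto
  next
    case 2
    then have "w i o\<^sub>L c = b" using w_commute[of b i] by (simp add: centered_def)
    then show ?thesis using 2 open_letters_centered by (auto simp: open_letters_def)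
  qed
qed

text \<open>Only the rightmost \<open>w j\<close> can merge with the head of \<open>xs\<close>. The
  \<open>w i\<close> before it shields everything further left, so the result starts with an
  untouched \<open>w i\<close>; one full factor is needed for this, hence
  \<open>Suc k\<close>.\<close>

lemma pair_power_regroup:
  assumes ij: "i \<noteq> j" and xs: "alternating (\<lambda>i. centered (gen_algebra i)) xs"
    and hd: "xs = [] \<or> snd (hd xs) \<in> open_letters (fst (hd xs))"
  shows "\<exists>ys. alternating (\<lambda>i. centered (gen_algebra i)) ys \<and> ys \<noteq> [] \<and> hd ys = (i, w i) \<and>
    word_op ys = pair_power w i j (Suc k) o\<^sub>L word_op xs"
proof (induction k)
  case 0
  have "\<exists>zs. alternating (\<lambda>i. centered (gen_algebra i)) zs \<and> zs \<noteq> [] \<and> fst (hd zs) = j \<and>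
    word_op zs = w j o\<^sub>L word_op xs"
  proof (cases "xs = [] \<or> fst (hd xs) \<noteq> j")
    case True
    then show ?thesis using xs w_centered by (intro exI[of _ "(j, w j) # xs"]) (auto simp: alternating_Cons)
  next
    case False
    then obtain c xs' where "xs = (j, c) # xs'" by (cases xs) auto
    then show ?thesis using xs hd w_open_letter
      by (intro exI[of _ "(j, w j o\<^sub>L c) # xs'"]) (auto simp: alternating_Cons blinfun_compose_assoc)
  qed
  then obtain zs where "alternating (\<lambda>i. centered (gen_algebra i)) zs" "zs \<noteq> []" "fst (hd zs) = j"
    "word_op zs = w j o\<^sub>L word_op xs" by blast
  then show ?case using ij w_centered
    by (intro exI[of _ "(i, w i) # zs"]) (auto simp: alternating_Cons blinfun_compose_assoc)
next
  case (Suc k)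
  then obtain ys where ys: "alternating (\<lambda>i. centered (gen_algebra i)) ys" "ys \<noteq> []" "hd ys = (i, w i)"
    "word_op ys = pair_power w i j (Suc k) o\<^sub>L word_op xs" by blast
  have "word_op ((i, w i) # (j, w j) # ys) = pair_power w i j (Suc (Suc k)) o\<^sub>L word_op xs"
    by (simp add: ys(4) blinfun_compose_assoc)
  then show ?case using ij w_centered ys
    by (intro exI[of _ "(i, w i) # (j, w j) # ys"]) (auto simp: alternating_Cons)
qed

text \<open>Only the last letter of \<open>bs\<close> can merge with \<open>xs\<close>, by absorbing
  a bare \<open>w i\<close> on its right. If \<open>bs\<close> has one letter, this letter is also
  the head, which is why open letters include the products \<open>b o\<^sub>L w i\<close>.\<close>

lemma real_word_regroup:
  assumes "bs \<in> real_words" "bs \<noteq> []" and xs: "alternating (\<lambda>i. centered (gen_algebra i)) xs"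
    and hd: "xs = [] \<or> (\<exists>i. hd xs = (i, w i))"
  shows "\<exists>ys. alternating (\<lambda>i. centered (gen_algebra i)) ys \<and> ys \<noteq> [] \<and>
    snd (hd ys) \<in> open_letters (fst (hd ys)) \<and> fst (hd ys) = fst (hd bs) \<and>
    word_op ys = word_op bs o\<^sub>L word_op xs"
  using assms(1,2)
proof (induction bs)
  case (Cons x bs)
  obtain i b where x: "x = (i, b)" by (cases x)
  have b: "b \<in> centered (gen_real_algebra i)" "b \<in> open_letters i" "b \<in> centered (gen_algebra i)"
    "b o\<^sub>L w i \<in> open_letters i" "b o\<^sub>L w i \<in> centered (gen_algebra i)"
    using Cons.prems x open_letters_centered[of i] by (auto simp: alternating_Cons open_letters_def)
  show ?case
  proof (cases "bs = []")
    case False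
    then obtain ys where "alternating (\<lambda>i. centered (gen_algebra i)) ys" "ys \<noteq> []" "fst (hd ys) = fst (hd bs)"
      "word_op ys = word_op bs o\<^sub>L word_op xs"
      using Cons x by (auto simp: alternating_Cons)
    then show ?thesis using False Cons.prems b x
      by (intro exI[of _ "(i, b) # ys"]) (auto simp: alternating_Cons blinfun_compose_assoc)
  next
    case bs: True
    show ?thesis
    proof (cases "xs = [] \<or> fst (hd xs) \<noteq> i")
      case True
      then show ?thesis using bs b x xs by (intro exI[of _ "(i, b) # xs"]) (auto simp: alternating_Cons)
    next
      case False
      then obtain xs' where "xs = (i, w i) # xs'" using hd by (cases xs) auto
      then show ?thesis using bs b x xs
        by (intro exI[of _ "(i, b o\<^sub>L w i) # xs'"]) (auto simp: alternating_Cons blinfun_compose_assoc)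
    qed
  qed
qed simp

text \<open>The \<open>w i\<close> are self-adjoint with square the identity, so
  \<open>w j o\<^sub>L w i\<close> is the inverse of \<open>w i o\<^sub>L w j\<close>: the second
  range holds the negative powers.\<close>

definition pair_powers :: "'n \<Rightarrow> 'n \<Rightarrow> 'n free_group ell2_op set" where
  "pair_powers i j = range (\<lambda>k. pair_power w i j (Suc k)) \<union> range (\<lambda>k. pair_power w j i (Suc k))"

abbreviation "free_generators i j \<equiv>
  (\<lambda>b. if b then pair_powers i j else word_op ` (real_words - {[]}))"

text \<open>Blocks are added from the right. The clause on the head records how the left end may
  still merge: a bare \<open>w p\<close> after a power, an open letter after a real word.\<close>

lemma free_generators_regroup:
  assumes ij: "i \<noteq> j" and "alternating (free_generators i j) xs" "xs \<noteq> []"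
  shows "\<exists>ys. alternating (\<lambda>i. centered (gen_algebra i)) ys \<and> ys \<noteq> [] \<and> word_op ys = word_op xs \<and>
    (if fst (hd xs) then \<exists>p. hd ys = (p, w p) else snd (hd ys) \<in> open_letters (fst (hd ys)))"
  using assms(2,3)
proof (induction xs)
  case (Cons x xs)
  obtain b a where x: "x = (b, a)" by (cases x)
  have a: "a \<in> free_generators i j b" "xs = [] \<or> fst (hd xs) \<noteq> b"
    using Cons.prems x by (auto simp: alternating_Cons)
  \<comment> \<open>The block to the right is of the other kind, so its invariant is exactly what
    the present block requires.\<close>
  obtain ys where ys: "alternating (\<lambda>i. centered (gen_algebra i)) ys" "word_op ys = word_op xs"
    "if b then ys = [] \<or> snd (hd ys) \<in> open_letters (fst (hd ys)) else ys = [] \<or> (\<exists>p. hd ys = (p, w p))"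
  proof (cases "xs = []")
    case True
    then show ?thesis using that[of "[]"] by simp
  next
    case False
    then have "fst (hd xs) = (\<not> b)" using a(2) by auto
    then show ?thesis using that Cons False x by (auto simp: alternating_Cons split: if_splits)
  qed
  show ?case
  proof (cases b)
    case True
    then obtain p q k where "p \<noteq> q" "a = pair_power w p q (Suc k)"
    proof -
      have "a \<in> pair_powers i j" using a(1) True by simp
      then show ?thesis unfolding pair_powers_def
        using that[of i j] that[of j i] ij by (elim UnE rangeE) (simp_all del: pair_power_simps)
    qed
    moreover have "ys = [] \<or> snd (hd ys) \<in> open_letters (fst (hd ys))" using ys(3) True by simp
    ultimately show ?thesis using pair_power_regroup[OF _ ys(1), of p q k] True x ys(2) by auto
  next
    case False
    then obtain bs where bs: "bs \<in> real_words" "bs \<noteq> []" "a = word_op bs" using a(1) by auto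
    moreover have "ys = [] \<or> (\<exists>p. hd ys = (p, w p))" using ys(3) False by simp
    ultimately show ?thesis using real_word_regroup[OF bs(1,2) ys(1)] False x ys(2) by auto
  qed
qed simp

text \<open>The integer powers of \<open>w i o\<^sub>L w j\<close>, applied to \<open>f\<close>, are
  permuted by it and by its adjoint \<open>w j o\<^sub>L w i\<close>.\<close>

lemma pair_dense:
  assumes a: "a \<in> vN_generated {w i o\<^sub>L w j}"
  shows "blinfun_apply a f \<in> closed_cspan (insert f ((\<lambda>g. blinfun_apply g f) ` pair_powers i j))"
proof -
  define V where "V = range (pair_power w i j) \<union> range (pair_power w j i)"
  have V: "w i o\<^sub>L (w j o\<^sub>L g) \<in> V" "w j o\<^sub>L (w i o\<^sub>L g) \<in> V" if "g \<in> V" for g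
  proof -
    have *: "w i o\<^sub>L (w j o\<^sub>L g) \<in> range (pair_power w i j) \<union> range (pair_power w j i)"
      if "g \<in> range (pair_power w i j) \<union> range (pair_power w j i)" for i j g
      using that
    proof (elim UnE rangeE)
      fix k assume "g = pair_power w i j k"
      then show ?thesis by (auto intro: range_eqI[of _ _ "Suc k"])
    next
      \<comment> \<open>One factor cancels; at \<open>k = 0\<close> the product is the first power
        of the opposite pair.\<close>
      fix k assume "g = pair_power w j i k"
      then show ?thesis by (cases k) (auto intro: range_eqI[of _ _ 1])
    qed
    show "w i o\<^sub>L (w j o\<^sub>L g) \<in> V" "w j o\<^sub>L (w i o\<^sub>L g) \<in> V"
      using *[of g i j] *[of g j i] that unfolding V_def by auto
  qed
  have "range (pair_power w p q) = insert id_blinfun (range (\<lambda>k. pair_power w p q (Suc k)))" for p q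
    by (subst UNIV_nat_eq) (simp add: image_image del: pair_power_simps(2))
  from this[of i j] this[of j i] have "V = insert id_blinfun (pair_powers i j)"
    unfolding V_def pair_powers_def by blast
  then have X: "insert f ((\<lambda>g. blinfun_apply g f) ` pair_powers i j) = (\<lambda>g. blinfun_apply g f) ` V" by simp
  have w_b: "w p \<in> bounded_ops" for p by (intro factor_bounded_ops w_in_factor)
  show ?thesis unfolding X
  proof (rule vN_generated_dense[OF _ _ _ a])
    show "{w i o\<^sub>L w j} \<subseteq> bounded_ops" by (simp add: bounded_ops_compose w_b)
    show "f \<in> (\<lambda>g. blinfun_apply g f) ` V"
      unfolding V_def by (rule image_eqI[of _ _ id_blinfun]) (auto intro: range_eqI[of _ _ 0])
    fix b h assume b: "b \<in> {w i o\<^sub>L w j} \<union> adj ` {w i o\<^sub>L w j}" and "h \<in> (\<lambda>g. blinfun_apply g f) ` V"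
    then obtain g where g: "g \<in> V" "h = blinfun_apply g f" by blast
    have bg: "b o\<^sub>L g \<in> V" using b V[OF g(1)] by (auto simp: adj_compose w_b w_adj blinfun_compose_assoc)
    have "blinfun_apply (b o\<^sub>L g) f \<in> closed_cspan ((\<lambda>g. blinfun_apply g f) ` V)"
      by (rule subsetD[OF closed_cspan_superset imageI[OF bg]])
    then show "blinfun_apply b h \<in> closed_cspan ((\<lambda>g. blinfun_apply g f) ` V)" by (simp add: g)
  qed
qed

lemma product_free_from_radial_masa:
  assumes ij: "i \<noteq> j"
  shows "unitary_free_from (w i o\<^sub>L w j) radial_masa"
  unfolding unitary_free_from_def
proof
  have w_b: "w p \<in> bounded_ops" for p by (intro factor_bounded_ops w_in_factor)
  show "unitary_op (w i o\<^sub>L w j)"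
    by (simp add: unitary_op_def bounded_ops_compose w_b adj_compose w_adj blinfun_compose_assoc w_sq)
  let ?A = "\<lambda>b. if b then vN_generated {w i o\<^sub>L w j} else radial_masa"
  let ?G = "\<lambda>b. if b then pair_powers i j else word_op ` (real_words - {[]})"
  have A: "?A b \<subseteq> free_group_factor" for b
    using vN_generated_subset_factor[of "{w i o\<^sub>L w j}"] factor_compose[OF w_in_factor w_in_factor]
    by (simp add: radial_masa_subset_factor)
  show "freely_independent free_group_factor canonical_trace UNIV ?A"
  \<comment> \<open>The family \<open>?G False\<close> spans the algebra of all the B_k, larger than
    what the radial MASA asks for, but its words are the ones that regroup.\<close>
  proof (rule freely_independentI[OF A], rule alternating_trace_zero[OF A])
    have "pair_powers i j \<subseteq> free_group_factor"
      unfolding pair_powers_def by (intro Un_least image_subsetI pair_power_in_factor)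
    moreover have "word_op ` (real_words - {[]}) \<subseteq> free_group_factor"
      by (rule image_subsetI) (erule DiffE, erule real_word_in_factor)
    ultimately show "?G b \<subseteq> free_group_factor" for b by (cases b) simp_all
    fix a :: "'n free_group ell2_op" and b
    let ?e = "\<lambda>g :: 'n free_group ell2_op. blinfun_apply g (delta 1)"
    assume a: "a \<in> ?A b"
    show "?e a \<in> closed_cspan (insert (delta 1) (?e ` ?G b))"
    proof (cases b)
      case True
      then show ?thesis using a pair_dense[of a i j "delta 1"] by simp
    next
      case False
      \<comment> \<open>The empty real word supplies \<open>delta 1\<close>, the vector inserted in
        the density condition; it must be removed from the letters because the identity is not
        centered.\<close>
      have split: "(\<lambda>bs. ?e (word_op bs)) ` R = insert (?e id_blinfun) (?e ` word_op ` (R - {[]}))"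
        if "[] \<in> R" for R :: "('n \<times> 'n free_group ell2_op) list set"
        by (subst insert_Diff[OF that, symmetric]) (simp only: image_insert image_image word_op_simps)
      have "a \<in> radial_masa" using a False by simp
      then have "?e a \<in> closed_cspan ((\<lambda>bs. ?e (word_op bs)) ` real_words)" by (rule radial_masa_dense)
      also have "(\<lambda>bs. ?e (word_op bs)) ` real_words = insert (?e id_blinfun) (?e ` word_op ` (real_words - {[]}))"
        by (rule split) simp
      finally show ?thesis using False by simp
    qed
  next
    show "canonical_trace (word_op xs) = 0" if xs: "alternating ?G xs" "xs \<noteq> []" for xs
    proof -
      obtain ys where "alternating (\<lambda>i. centered (gen_algebra i)) ys" "ys \<noteq> []" "word_op ys = word_op xs"
        using free_generators_regroup[OF ij xs] by blast
      then show ?thesis using gen_algebras_free[of ys] by simp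
    qed
  qed
qed

end

theorem theorem1p3:
  fixes \<Phi> :: "'n::finite \<Rightarrow> (real \<Rightarrow> complex) \<Rightarrow> 'n free_group ell2_op"
    and w :: "'n \<Rightarrow> 'n free_group ell2_op"
  assumes "CARD('n) \<ge> 2"
    and "\<And>i. Linf_isomorphism (\<Phi> i) (gen_algebra i)"
    and "\<And>i. \<Phi> i ` Linf_even = gen_real_algebra i"
    and "\<And>i. w i = \<Phi> i (\<lambda>x. complex_of_real (\<bar>x\<bar> / x))"
  shows "\<forall>i j. i \<noteq> j \<longrightarrow> unitary_free_from (w i o\<^sub>L w j) radial_masa"
\<comment> \<open>Each property of \<open>w i\<close> is one of the sign function carried through
  \<open>\<Phi> i\<close>: real values give self-adjointness, square 1 almost everywhere gives the
  involution, commuting functions give commutation with B_i, and oddness gives trace zero.\<close>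
proof (intro allI impI, rule product_free_from_radial_masa)
  fix i
  have \<Phi>: "\<And>f g. f \<in> Linf \<Longrightarrow> g \<in> Linf \<Longrightarrow> \<Phi> i f = \<Phi> i g \<longleftrightarrow> (AE x in interval_measure. f x = g x)"
    "\<Phi> i ` Linf = gen_algebra i"
    "\<And>f g. f \<in> Linf \<Longrightarrow> g \<in> Linf \<Longrightarrow> \<Phi> i (\<lambda>x. f x * g x) = \<Phi> i f o\<^sub>L \<Phi> i g"
    "\<And>f. f \<in> Linf \<Longrightarrow> \<Phi> i (\<lambda>x. cnj (f x)) = adj (\<Phi> i f)"
    "\<And>f. f \<in> Linf \<Longrightarrow> canonical_trace (\<Phi> i f) = (LINT x|interval_measure. f x)"
    using assms(2)[of i] unfolding Linf_isomorphism_def by blast+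
  have w: "w i = \<Phi> i sign_function" by (simp add: assms(4) sign_function_def[abs_def])
  note s = sign_function_Linf
  show "w i \<in> gen_algebra i" using \<Phi>(2) w s by blast
  show "adj (w i) = w i" using \<Phi>(4)[OF s] by (simp add: w sign_function_def[abs_def])
  have one: "(\<lambda>_. 1) \<in> Linf" by (rule borel_in_Linf[of _ 1]) auto
  \<comment> \<open>Preservation of the unit follows from surjectivity: if \<open>f\<close> is sent
    to the identity, then so is 1 times \<open>f\<close>, and its image is also that of 1 composed
    with the identity.\<close>
  obtain f where f: "f \<in> Linf" "\<Phi> i f = id_blinfun"
    using \<Phi>(2) vN_generated_id unfolding gen_algebra_def by (metis imageE)
  have "\<Phi> i (\<lambda>_. 1) = id_blinfun" using \<Phi>(3)[OF one f(1)] f(2) by simp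
  then show "w i o\<^sub>L w i = id_blinfun"
    using \<Phi>(1)[OF Linf_mult[OF s s] one] sign_function_squared \<Phi>(3)[OF s s] w by simp
  fix b assume "b \<in> gen_real_algebra i"
  then obtain f where f: "f \<in> Linf_even" "b = \<Phi> i f" using assms(3) by blast
  then have f': "f \<in> Linf" by (simp add: Linf_even_def)
  show "b o\<^sub>L w i = w i o\<^sub>L b"
    using \<Phi>(3)[OF s f'] \<Phi>(3)[OF f' s] by (simp add: f w mult.commute)
  show "canonical_trace (w i o\<^sub>L b) = 0"
    using \<Phi>(5)[OF Linf_mult[OF s f']] integral_sign_function_even[OF f(1)] \<Phi>(3)[OF s f'] by (simp add: f w)
qed

end
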